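(* Let $G$ be a Polish group with a countable neighbourhood basis $\mathcal S_G$ of the neutral element consisting of open subgroups, such that $\mathcal S_G$ is invariant under the natural action of $\mathrm{Aut}(G)$ on open subgroups (i.e. $\Phi(U)\in\mathcal S_G$ for all $\Phi\in\mathrm{Aut}(G)$ and $U\in\mathcal S_G$). Then: (i) There is a closed subgroup $\hat G$ of $S_\infty$ and a topological group isomorphism $\Theta\colon G\to\hat G$ such that the map sending $\alpha\in N_{S_\infty}(\hat G)$ to the automorphism $g\mapsto \Theta^{-1}(\alpha\,\Theta(g)\,\alpha^{-1})$ of $G$ is a surjective homomorphism $N_{S_\infty}(\hat G)\to\mathrm{Aut}(G)$ with kernel $C_{S_\infty}(\hat G)$; thus $N_{S_\infty}(\hat G)/C_{S_\infty}(\hat G)\cong \mathrm{Aut}(G)$. Transferring the quotient topology via this isomorphism, $\mathrm{Aut}(G)$ becomes a non-Archimedean Polish group whose action on $G$ (given by $(\Phi,g)\mapsto\Phi(g)$) is continuous. (ii) A neighbourhood basis of the identity for this topology on $\mathrm{Aut}(G)$ is given by the subgroups of the form $\{\Phi\in\mathrm{Aut}(G)\colon \Phi(A_i)=A_i \text{ for all } i=1,\dots,n\}$, where $n\ge 1$ and $A_1,\dots,A_n$ are cosets of subgroups in $\mathcal S_G$. (iii) This topology on $\mathrm{Aut}(G)$ is the unique Polish topology on $\mathrm{Aut}(G)$ that makes the action of $\mathrm{Aut}(G)$ on $G$ continuous.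
   Context: $S_\infty$ denotes the Polish group of all permutations of $\mathbb N$ with the topology of pointwise convergence. For a closed subgroup $H\le S_\infty$, $N_{S_\infty}(H)$ and $C_{S_\infty}(H)$ denote its normaliser and centraliser in $S_\infty$. $\mathrm{Aut}(G)$ denotes the group of (bi-)continuous automorphisms of the topological group $G$. A Polish group is non-Archimedean if it has a countable neighbourhood basis of the identity consisting of open subgroups. *)

theory Defs
  imports "HOL-Analysis.Analysis" "HOL-Algebra.Bij" "HOL-Algebra.Group_Action"
begin

definition topological_group :: "('a, 'b) monoid_scheme \<Rightarrow> 'a topology \<Rightarrow> bool" where
  "topological_group G T \<longleftrightarrow>
     group G \<and> topspace T = carrier G \<and>
     continuous_map (prod_topology T T) T (\<lambda>(x, y). x \<otimes>\<^bsub>G\<^esub> y) \<and>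
     continuous_map T T (\<lambda>x. inv\<^bsub>G\<^esub> x)"

definition polish_group :: "('a, 'b) monoid_scheme \<Rightarrow> 'a topology \<Rightarrow> bool" where
  "polish_group G T \<longleftrightarrow>
     topological_group G T \<and> separable_space T \<and> completely_metrizable_space T"

text \<open>Members of a neighbourhood basis are required to be neighbourhoods, but not to be open;
  the library predicate \<^const>\<open>neighbourhood_base_at\<close> only says that there are enough of them.\<close>

definition neighbourhood_basis :: "'a topology \<Rightarrow> 'a \<Rightarrow> 'a set set \<Rightarrow> bool" where
  "neighbourhood_basis X x \<B> \<longleftrightarrow>
     (\<forall>V\<in>\<B>. V \<subseteq> topspace X \<and> (\<exists>U. openin X U \<and> x \<in> U \<and> U \<subseteq> V)) \<and>
     neighbourhood_base_at x (\<lambda>V. V \<in> \<B>) X"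

definition open_subgroup_basis ::
    "('a, 'b) monoid_scheme \<Rightarrow> 'a topology \<Rightarrow> 'a set set \<Rightarrow> bool" where
  "open_subgroup_basis G T \<S> \<longleftrightarrow>
     countable \<S> \<and> (\<forall>U\<in>\<S>. subgroup U G \<and> openin T U) \<and>
     neighbourhood_basis T \<one>\<^bsub>G\<^esub> \<S>"

definition non_archimedean :: "('a, 'b) monoid_scheme \<Rightarrow> 'a topology \<Rightarrow> bool" where
  "non_archimedean G T \<longleftrightarrow> (\<exists>\<S>. open_subgroup_basis G T \<S>)"

text \<open>As in \<^const>\<open>AutoGroup\<close>, automorphisms are functions that are extensional on the carrier.\<close>

definition TopAut :: "('a, 'b) monoid_scheme \<Rightarrow> 'a topology \<Rightarrow> ('a \<Rightarrow> 'a) monoid" where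
  "TopAut G T = AutoGroup G \<lparr>carrier := {\<Phi> \<in> auto G. homeomorphic_map T T \<Phi>}\<rparr>"

definition Sinf :: "(nat \<Rightarrow> nat) monoid" where
  "Sinf = BijGroup UNIV"

definition Sinf_top :: "(nat \<Rightarrow> nat) topology" where
  "Sinf_top = subtopology (product_topology (\<lambda>_. discrete_topology UNIV) UNIV) (carrier Sinf)"

definition centralizer :: "('a, 'b) monoid_scheme \<Rightarrow> 'a set \<Rightarrow> 'a set" where
  "centralizer G H = {x \<in> carrier G. \<forall>h\<in>H. x \<otimes>\<^bsub>G\<^esub> h = h \<otimes>\<^bsub>G\<^esub> x}"

definition quotient_topology :: "'a topology \<Rightarrow> ('a \<Rightarrow> 'b) \<Rightarrow> 'b topology" where
  "quotient_topology X q =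
     topology (\<lambda>V. V \<subseteq> q ` topspace X \<and> openin X {x \<in> topspace X. q x \<in> V})"

lemma openin_quotient_topology:
  "openin (quotient_topology X q) V \<longleftrightarrow>
     V \<subseteq> q ` topspace X \<and> openin X {x \<in> topspace X. q x \<in> V}"
proof -
  have "istopology (\<lambda>V. V \<subseteq> q ` topspace X \<and> openin X {x \<in> topspace X. q x \<in> V})"
    unfolding istopology_def
  proof (intro conjI allI impI; (elim conjE)?)
    fix S V assume "openin X {x \<in> topspace X. q x \<in> S}" "openin X {x \<in> topspace X. q x \<in> V}"
    moreover have "{x \<in> topspace X. q x \<in> S \<inter> V} =
        {x \<in> topspace X. q x \<in> S} \<inter> {x \<in> topspace X. q x \<in> V}" by auto
    ultimately show "openin X {x \<in> topspace X. q x \<in> S \<inter> V}" by auto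
  next
    fix \<K> assume *: "\<forall>K\<in>\<K>. K \<subseteq> q ` topspace X \<and> openin X {x \<in> topspace X. q x \<in> K}"
    have "{x \<in> topspace X. q x \<in> \<Union>\<K>} = (\<Union>K\<in>\<K>. {x \<in> topspace X. q x \<in> K})" by auto
    with * show "openin X {x \<in> topspace X. q x \<in> \<Union>\<K>}" by auto
  qed blast+
  then show ?thesis
    by (simp add: quotient_topology_def topology_inverse')
qed

lemma topspace_quotient_topology: "topspace (quotient_topology X q) = q ` topspace X"
proof (rule equalityI)
  show "topspace (quotient_topology X q) \<subseteq> q ` topspace X"
    using openin_quotient_topology [of X q] openin_topspace by blast
  have "{x \<in> topspace X. q x \<in> q ` topspace X} = topspace X" by auto
  then have "openin (quotient_topology X q) (q ` topspace X)"
    by (simp add: openin_quotient_topology)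
  then show "q ` topspace X \<subseteq> topspace (quotient_topology X q)"
    by (rule openin_subset)
qed

lemma quotient_map_quotient_topology: "quotient_map X (quotient_topology X q) q"
  by (auto simp: quotient_map_def topspace_quotient_topology openin_quotient_topology)

definition FactGroup_top :: "('a, 'b) monoid_scheme \<Rightarrow> 'a topology \<Rightarrow> 'a set \<Rightarrow> 'a set topology" where
  "FactGroup_top G T H = quotient_topology T (\<lambda>x. H #>\<^bsub>G\<^esub> x)"

definition conj_aut ::
    "('a, 'b) monoid_scheme \<Rightarrow> ('a \<Rightarrow> nat \<Rightarrow> nat) \<Rightarrow> (nat \<Rightarrow> nat) \<Rightarrow> 'a \<Rightarrow> 'a" where
  "conj_aut G \<Theta> \<alpha> =
     (\<lambda>g\<in>carrier G. inv_into (carrier G) \<Theta> (\<alpha> \<otimes>\<^bsub>Sinf\<^esub> \<Theta> g \<otimes>\<^bsub>Sinf\<^esub> inv\<^bsub>Sinf\<^esub> \<alpha>))"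

definition cosets_of :: "('a, 'b) monoid_scheme \<Rightarrow> 'a set set \<Rightarrow> 'a set set" where
  "cosets_of G \<S> = {A. \<exists>U\<in>\<S>. \<exists>g\<in>carrier G. A = g <#\<^bsub>G\<^esub> U \<or> A = U #>\<^bsub>G\<^esub> g}"

definition coset_stabilizers ::
    "('a, 'b) monoid_scheme \<Rightarrow> 'a topology \<Rightarrow> 'a set set \<Rightarrow> ('a \<Rightarrow> 'a) set set" where
  "coset_stabilizers G T \<S> =
     {{\<Phi> \<in> carrier (TopAut G T). \<forall>i\<in>{1..n}. \<Phi> ` A i = A i} | (n::nat) A.
        n \<ge> 1 \<and> (\<forall>i\<in>{1..n}. A i \<in> cosets_of G \<S>)}"

end

theory Submission
  imports Defs
begin

text \<open>Let \<open>\<Omega>\<close> be the countable set of left cosets of members of \<open>\<S>\<close>. By invariance, it contains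
  the right cosets as well and is permuted by \<open>Aut(G)\<close>. Left translation embeds \<open>G\<close> homeomorphically
  into the symmetric group of \<open>\<Omega>\<close>; the image is closed because a Polish subgroup of a Polish group is a
  dense \<open>G\<^sub>\<delta>\<close> in its closure and all its cosets in the closure would have to meet it. The permutation
  \<open>\<Gamma> \<Phi>\<close> of \<open>\<Omega>\<close> induced by \<open>\<Phi>\<close> normalises the image and conjugation by it is \<open>\<Phi>\<close>, so \<open>\<Gamma>\<close> is a
  homomorphic section of \<open>\<Psi>\<close>. As \<open>\<Gamma> \<circ> \<Psi>\<close> is continuous, the quotient topology
  is the topology that \<open>Aut(G)\<close> inherits from the closed subgroup \<open>\<Gamma> ` Aut(G)\<close>.

  For uniqueness, the stabiliser of a coset is closed of countable index in any Polish
  topology \<open>\<sigma>\<close> with continuous action, hence open, so \<open>\<sigma>\<close> refines \<open>\<tau>\<close>; and comparable Polish group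
  topologies coincide.\<close>

section \<open>Topological groups and Baire category\<close>

text \<open>Cosets, not only the members of \<open>\<S>\<close>, serve as points because the value
  of \<open>\<theta> g\<close> at the coset \<open>U\<close> records \<open>g\<close> up to
  \<open>U\<close>, so that agreement at cosets is closeness in \<open>G\<close>. Invariance of
  \<open>\<S>\<close> also makes the preimage of a basic subgroup under an automorphism basic again,
  and the continuity of the action rests on this. A quotient topology gives little direct access to
  neighbourhoods; the section \<open>\<Gamma>\<close> turns it into a topology induced by a map into
  \<open>Sinf\<close>, where neighbourhoods are conditions on finitely many values.

  The last assertion of the overview is an open mapping theorem for an identity map. Baire category
  alone shows only that an open set of the finer topology lies in the interior of its closure for
  the coarser one. The gap is closed by showing that such a set exhausts that interior up to a
  meagre set, and then by intersecting with a translate.\<close>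

locale topgroup =
  fixes G (structure) and T
  assumes topological_group: "topological_group G T"
begin

sublocale group G
  using topological_group by (simp add: topological_group_def)

lemma topspace_eq: "topspace T = carrier G"
  using topological_group by (simp add: topological_group_def)

text \<open>The arbitrary source \<open>X\<close> allows continuity of any expression built from the
  group operations to be derived by introduction rules.\<close>

lemma continuous_map_mult:
  assumes "continuous_map X T f" "continuous_map X T g"
  shows "continuous_map X T (\<lambda>x. f x \<otimes> g x)"
proof -
  have "continuous_map X (prod_topology T T) (\<lambda>x. (f x, g x))"
    using assms by (rule continuous_map_pairedI)
  moreover have "continuous_map (prod_topology T T) T (\<lambda>(x, y). x \<otimes> y)"
    using topological_group by (simp add: topological_group_def)
  ultimately have "continuous_map X T ((\<lambda>(x, y). x \<otimes> y) \<circ> (\<lambda>x. (f x, g x)))"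
    by (rule continuous_map_compose)
  then show ?thesis by (simp add: o_def)
qed

lemma continuous_map_inv:
  assumes "continuous_map X T f"
  shows "continuous_map X T (\<lambda>x. inv (f x))"
proof -
  have "continuous_map T T (m_inv G)"
    using topological_group by (simp add: topological_group_def)
  with assms have "continuous_map X T (m_inv G \<circ> f)"
    by (rule continuous_map_compose)
  then show ?thesis by (simp add: o_def)
qed

lemma continuous_map_constant: "a \<in> carrier G \<Longrightarrow> continuous_map X T (\<lambda>x. a)"
  by (simp add: topspace_eq)

lemma homeomorphic_map_lmult:
  assumes a: "a \<in> carrier G"
  shows "homeomorphic_map T T (\<lambda>x. a \<otimes> x)"
proof -
  have "homeomorphic_maps T T (\<lambda>x. a \<otimes> x) (\<lambda>x. inv a \<otimes> x)"
    unfolding homeomorphic_maps_def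
    using a by (auto intro!: continuous_map_mult continuous_map_constant
        simp: topspace_eq simp flip: m_assoc)
  then show ?thesis by (rule homeomorphic_maps_imp_map)
qed

lemma l_coset_image: "a <# U = (\<lambda>x. a \<otimes> x) ` U"
  by (auto simp: l_coset_def)

lemma openin_l_coset:
  "a \<in> carrier G \<Longrightarrow> openin T U \<Longrightarrow> openin T (a <# U)"
  unfolding l_coset_image using homeomorphic_map_openness_eq [OF homeomorphic_map_lmult] by blast

lemma closedin_l_coset:
  "a \<in> carrier G \<Longrightarrow> closedin T U \<Longrightarrow> closedin T (a <# U)"
  unfolding l_coset_image using homeomorphic_map_closedness_eq [OF homeomorphic_map_lmult] by blast

lemma l_coset_mem_iff:
  assumes "a \<in> carrier G" "x \<in> carrier G" "U \<subseteq> carrier G"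
  shows "x \<in> a <# U \<longleftrightarrow> inv a \<otimes> x \<in> U"
proof
  assume "inv a \<otimes> x \<in> U"
  moreover have "x = a \<otimes> (inv a \<otimes> x)" using assms by (simp flip: m_assoc)
  ultimately show "x \<in> a <# U" unfolding l_coset_def by blast
next
  assume "x \<in> a <# U"
  then obtain u where "u \<in> U" "x = a \<otimes> u" by (auto simp: l_coset_def)
  then show "inv a \<otimes> x \<in> U" using assms by (simp flip: m_assoc add: subsetD)
qed

text \<open>For a point \<open>u\<close> of \<open>U\<close>, the translates of \<open>U\<close> by
  \<open>k \<otimes> inv u\<close> with \<open>k\<close> in \<open>K\<close> stay inside
  \<open>K\<close> and cover it.\<close>

lemma open_subgroupI:
  assumes K: "subgroup K G" and U: "openin T U" "U \<subseteq> K" "U \<noteq> {}"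
  shows "openin T K"
proof -
  interpret K: subgroup K G by (rule K)
  obtain u where u: "u \<in> U" using U by blast
  have K_eq: "K = (\<Union>k\<in>K. (k \<otimes> inv u) <# U)"
  proof (intro equalityI subsetI)
    fix k assume k: "k \<in> K"
    have "k = (k \<otimes> inv u) \<otimes> u" using k u U by (simp add: m_assoc subsetD)
    then show "k \<in> (\<Union>k\<in>K. (k \<otimes> inv u) <# U)"
      using k u by (auto simp: l_coset_def)
  next
    fix x assume "x \<in> (\<Union>k\<in>K. (k \<otimes> inv u) <# U)"
    then show "x \<in> K" using u U by (auto simp: l_coset_def subsetD)
  qed
  have "openin T (\<Union>k\<in>K. (k \<otimes> inv u) <# U)"
    using u U by (intro openin_Union) (auto intro!: openin_l_coset)
  then show ?thesis by (subst K_eq)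
qed

lemma open_subgroup_closed:
  assumes K: "subgroup K G" and "openin T K"
  shows "closedin T K"
proof -
  interpret K: subgroup K G by (rule K)
  have "topspace T - K = (\<Union>x\<in>carrier G - K. x <# K)"
  proof (intro equalityI subsetI)
    fix x assume "x \<in> topspace T - K"
    then show "x \<in> (\<Union>x\<in>carrier G - K. x <# K)"
      using K.subset by (intro UN_I[of x]) (auto simp: topspace_eq l_coset_mem_iff)
  next
    fix y assume "y \<in> (\<Union>x\<in>carrier G - K. x <# K)"
    then obtain x k where x: "x \<in> carrier G" "x \<notin> K" and k: "k \<in> K" "y = x \<otimes> k"
      by (auto simp: l_coset_def)
    have "x = y \<otimes> inv k" using x k by (simp add: m_assoc)
    then have "y \<notin> K" using x(2) k(1) by (metis K.m_closed K.m_inv_closed)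
    then show "y \<in> topspace T - K" using x k by (simp add: topspace_eq)
  qed
  moreover have "openin T (\<Union>x\<in>carrier G - K. x <# K)"
    using assms by (intro openin_Union) (auto intro: openin_l_coset)
  ultimately show ?thesis
    using K.subset by (simp add: closedin_def topspace_eq)
qed

lemma subgroup_topological_group:
  assumes "subgroup K G"
  shows "topological_group (G\<lparr>carrier := K\<rparr>) (subtopology T K)"
proof -
  interpret K: subgroup K G by (rule assms)
  have "continuous_map (prod_topology T T) T (\<lambda>(x, y). x \<otimes> y)"
    using topological_group by (simp add: topological_group_def)
  then have "continuous_map (prod_topology (subtopology T K) (subtopology T K)) T (\<lambda>(x, y). x \<otimes> y)"
    by (simp add: continuous_map_from_subtopology flip: subtopology_Times)
  then have "continuous_map (prod_topology (subtopology T K) (subtopology T K)) (subtopology T K)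
      (\<lambda>(x, y). x \<otimes>\<^bsub>G\<lparr>carrier := K\<rparr>\<^esub> y)"
    by (auto simp: continuous_map_in_subtopology)
  moreover have "continuous_map (subtopology T K) T (\<lambda>x. inv x)"
    by (intro continuous_map_inv continuous_map_from_subtopology continuous_map_id[unfolded id_def])
  then have "continuous_map (subtopology T K) (subtopology T K) (\<lambda>x. inv\<^bsub>G\<lparr>carrier := K\<rparr>\<^esub> x)"
    by (auto simp: continuous_map_in_subtopology assms elim!: continuous_map_eq)
  ultimately show ?thesis
    unfolding topological_group_def
    using subgroup_imp_group[OF assms] K.subset by (simp add: topspace_eq inf.absorb2)
qed

text \<open>The closure of \<open>H \<times> H\<close> is the product of the closures, so continuity
  of the operations carries over from \<open>H\<close>.\<close>

lemma subgroup_closure_of: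
  assumes "subgroup H G"
  shows "subgroup (T closure_of H) G"
proof (intro subgroupI)
  interpret H: subgroup H G by (rule assms)
  show "T closure_of H \<subseteq> carrier G"
    by (metis closure_of_subset_topspace topspace_eq)
  show "T closure_of H \<noteq> {}"
    by (metis H.one_closed H.subset all_not_in_conv closure_of_subset subsetD topspace_eq)
  fix x assume x: "x \<in> T closure_of H"
  have "continuous_map T T (m_inv G)"
    using continuous_map_inv[OF continuous_map_id] by simp
  from continuous_map_image_closure_subset[OF this, of H]
  have "(m_inv G) ` (T closure_of H) \<subseteq> T closure_of H"
    by (rule order_trans) (auto intro!: closure_of_mono)
  then show "inv x \<in> T closure_of H" using x by auto
  fix y assume y: "y \<in> T closure_of H"
  have "continuous_map (prod_topology T T) T (\<lambda>(x, y). x \<otimes> y)"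
    using topological_group by (simp add: topological_group_def)
  from continuous_map_image_closure_subset[OF this, of "H \<times> H"]
  have "(\<lambda>(x, y). x \<otimes> y) ` ((T closure_of H) \<times> (T closure_of H)) \<subseteq> T closure_of H"
    unfolding closure_of_Times
    by (rule order_trans) (auto intro!: closure_of_mono)
  then show "x \<otimes> y \<in> T closure_of H" using x y by auto
qed

text \<open>The map \<open>f\<close> is a labelling whose fibres lie in single left cosets of
  \<open>K\<close>, so its countable range bounds the number of cosets. If \<open>K\<close> were not
  open, it and all its cosets would have empty interior, and countably many such closed sets would
  cover a Baire space.\<close>

lemma closed_subgroup_countable_index_open:
  assumes T: "completely_metrizable_space T" and K: "subgroup K G" "closedin T K"
    and f: "countable (f ` carrier G)"
      "\<And>x y. x \<in> carrier G \<Longrightarrow> y \<in> carrier G \<Longrightarrow> f x = f y \<Longrightarrow> inv x \<otimes> y \<in> K"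
  shows "openin T K"
proof (rule ccontr)
  assume nopen: "\<not> openin T K"
  interpret K: subgroup K G by (rule K)
  have int: "T interior_of K = {}"
    using open_subgroupI[OF K(1) openin_interior_of interior_of_subset] nopen by blast
  let ?\<G> = "(\<lambda>x. x <# K) ` carrier G"
  have "(\<lambda>x. x <# K) x = (\<lambda>c. SOME x. x \<in> carrier G \<and> f x = c) (f x) <# K" if "x \<in> carrier G" for x
  proof -
    define y where "y = (SOME y. y \<in> carrier G \<and> f y = f x)"
    have y: "y \<in> carrier G" "f y = f x"
      using someI[of "\<lambda>y. y \<in> carrier G \<and> f y = f x" x] that by (auto simp: y_def)
    have "x \<in> y <# K" using f(2)[OF y(1) that y(2)] that y K.subset by (simp add: l_coset_mem_iff)
    then have "x <# K = y <# K"
      using K(1) y(1) by (metis l_repr_independence)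
    then show ?thesis by (simp add: y_def)
  qed
  then have "?\<G> \<subseteq> (\<lambda>c. (SOME x. x \<in> carrier G \<and> f x = c) <# K) ` (f ` carrier G)"
    by auto
  then have "countable ?\<G>" using f(1) by (meson countable_image countable_subset)
  moreover have "closedin T C \<and> T interior_of C = {}" if C: "C \<in> ?\<G>" for C
  proof -
    obtain x where x: "x \<in> carrier G" "C = x <# K" using C by auto
    have "T interior_of C = (\<lambda>k. x \<otimes> k) ` (T interior_of K)"
      unfolding x l_coset_image
      by (rule homeomorphic_map_interior_of[OF homeomorphic_map_lmult]) (auto simp: x topspace_eq)
    then show ?thesis using int x K closedin_l_coset by simp
  qed
  ultimately have "T interior_of \<Union>?\<G> = {}"
    by (intro Baire_category_alt) (use T in auto)
  moreover have "\<Union>?\<G> = topspace T"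
    unfolding topspace_eq
  proof (intro equalityI subsetI)
    fix x assume "x \<in> carrier G"
    then show "x \<in> \<Union>?\<G>"
      using K.subset by (intro UN_I[of x]) (auto simp: l_coset_mem_iff)
  qed (use l_coset_subset_G[OF K.subset] in auto)
  ultimately show False using interior_of_topspace[of T] topspace_eq one_closed by auto
qed

text \<open>Each open set in a G-delta representation of \<open>H\<close> contains the dense set
  \<open>H\<close>, so it is dense, as is its translate by \<open>g\<close>. Baire category applied
  to both families at once yields a common point of \<open>H\<close> and
  \<open>g <# H\<close>.\<close>

lemma dense_gdelta_subgroup_eq:
  assumes T: "completely_metrizable_space T" and H: "subgroup H G" "gdelta_in T H"
    and dense: "T closure_of H = carrier G"
  shows "H = carrier G"
proof (intro equalityI subsetI)
  interpret H: subgroup H G by (rule H)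
  show "x \<in> carrier G" if "x \<in> H" for x using that by simp
  fix g assume g: "g \<in> carrier G"
  obtain \<U> where \<U>: "countable \<U>" "\<And>U. U \<in> \<U> \<Longrightarrow> openin T U" "H = \<Inter>\<U>"
    using H(2) unfolding gdelta_in_alt intersection_of_def by auto
  let ?\<V> = "\<U> \<union> (\<lambda>U. g <# U) ` \<U>"
  have "T closure_of (\<Inter>?\<V>) = topspace T"
  proof (rule Baire_category)
    show "completely_metrizable_space T \<or> locally_compact_space T \<and> regular_space T"
      using T by simp
    show "countable ?\<V>" using \<U> by auto
    fix V assume "V \<in> ?\<V>"
    moreover have U: "openin T U \<and> T closure_of U = topspace T" if "U \<in> \<U>" for U
    proof -
      have "T closure_of H \<subseteq> T closure_of U" using \<U> that by (intro closure_of_mono) auto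
      then show ?thesis using \<U> that dense closure_of_subset_topspace[of T U] by (auto simp: topspace_eq)
    qed
    moreover have "openin T (g <# U) \<and> T closure_of (g <# U) = topspace T" if "U \<in> \<U>" for U
    proof -
      have "T closure_of (g <# U) = (\<lambda>x. g \<otimes> x) ` (T closure_of U)"
        unfolding l_coset_image
        by (intro homeomorphic_map_closure_of[OF homeomorphic_map_lmult] g) (metis U openin_subset that)
      also have "\<dots> = topspace T" using U[OF that] homeomorphic_imp_surjective_map[OF homeomorphic_map_lmult[OF g]] by simp
      finally show ?thesis using U[OF that] openin_l_coset[OF g] by auto
    qed
    ultimately show "openin T V \<and> T closure_of V = topspace T" by auto
  qed
  then have "\<Inter>?\<V> \<noteq> {}" using one_closed topspace_eq by force
  then obtain z where z: "z \<in> \<Inter>?\<V>" by blast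
  then have zH: "z \<in> H" using \<U> by auto
  have "inv g \<otimes> z \<in> U" if "U \<in> \<U>" for U
  proof -
    have "z \<in> g <# U" using z that by auto
    then show ?thesis using zH g \<U>(2)[OF that] openin_subset topspace_eq
      by (subst l_coset_mem_iff[symmetric]) auto
  qed
  then have "inv g \<otimes> z \<in> H" using \<U> by auto
  then have "z \<otimes> inv (inv g \<otimes> z) \<in> H" using zH by simp
  then show "g \<in> H" using g zH by (simp add: inv_mult_group flip: m_assoc)
qed

lemma completely_metrizable_subgroup_closed:
  assumes T: "completely_metrizable_space T" and H: "subgroup H G"
    and TH: "completely_metrizable_space (subtopology T H)"
  shows "closedin T H"
proof -
  interpret H: subgroup H G by (rule H)
  let ?K = "T closure_of H"
  have K: "subgroup ?K G" by (rule subgroup_closure_of[OF H])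
  have HK: "H \<subseteq> ?K" by (simp add: closure_of_subset topspace_eq H.subset)
  interpret K: topgroup "G\<lparr>carrier := ?K\<rparr>" "subtopology T ?K"
    using subgroup_topological_group[OF K] by unfold_locales
  have "H = carrier (G\<lparr>carrier := ?K\<rparr>)"
  proof (rule K.dense_gdelta_subgroup_eq)
    show cm: "completely_metrizable_space (subtopology T ?K)"
      by (intro completely_metrizable_space_closedin T) auto
    show "subgroup H (G\<lparr>carrier := ?K\<rparr>)" by (rule subgroup_incl[OF H K HK])
    show "gdelta_in (subtopology T ?K) H"
      using cm HK TH by (intro completely_metrizable_space_imp_gdelta_in completely_metrizable_imp_metrizable_space)
        (auto simp: subtopology_subtopology inf.absorb2 topspace_eq H.subset)
    show "subtopology T ?K closure_of H = carrier (G\<lparr>carrier := ?K\<rparr>)"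
      using HK by (simp add: closure_of_subtopology inf.absorb2)
  qed
  then have "H = ?K" by simp
  then show ?thesis using closedin_closure_of[of T H] by argo
qed

end

section \<open>Almost open sets in comparable topologies\<close>

lemma metrizable_separable_imp_second_countable:
  assumes "metrizable_space X" "separable_space X"
  shows "second_countable X"
proof -
  obtain M d where "Metric_space M d" and X: "X = Metric_space.mtopology M d"
    using assms(1) unfolding metrizable_space_def by blast
  interpret Metric_space M d by fact
  obtain C where C: "countable C" "C \<subseteq> M" "mtopology closure_of C = M"
    using assms(2) unfolding separable_space_def X by auto
  define \<B> where "\<B> = (\<lambda>(c, n). mball c (1 / Suc n)) ` (C \<times> (UNIV :: nat set))"
  have "countable \<B>" unfolding \<B>_def using C by auto
  moreover have "\<forall>V\<in>\<B>. openin mtopology V" by (auto simp: \<B>_def)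
  moreover have "\<exists>V\<in>\<B>. x \<in> V \<and> V \<subseteq> U" if U: "openin mtopology U" "x \<in> U" for U x
  proof -
    have xM: "x \<in> M" using U openin_subset by fastforce
    obtain r where r: "r > 0" "mball x r \<subseteq> U"
      using U by (metis openin_mtopology)
    \<comment> \<open>Half of \<open>r\<close>, since the ball around \<open>c\<close> must reach
      \<open>x\<close> and still stay within distance \<open>r\<close> of it.\<close>
    obtain n where n: "1 / real (Suc n) < r / 2" using nat_approx_posE[of "r / 2"] r by auto
    obtain c where c: "c \<in> C" "c \<in> mball x (1 / Suc n)"
      using C(3) xM by (auto simp: metric_closure_of set_eq_iff dest!: spec[of _ x] spec[of _ "1 / real (Suc n)"])
    have "mball c (1 / Suc n) \<subseteq> mball x r"
      using c n xM by (intro mball_subset) (auto simp: commute)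
    then show ?thesis
      using c r xM by (intro bexI[of _ "mball c (1 / Suc n)"]) (auto simp: \<B>_def commute)
  qed
  ultimately show ?thesis unfolding second_countable_def X by blast
qed

text \<open>Outside the meagre set \<open>\<Union>\<G>\<close>, a point of \<open>Y interior_of (Y closure_of V)\<close> stays in the corresponding sets
  of a shrinking sequence of \<open>X\<close>-open sets, whose \<open>X\<close>-limit must then be the point itself.\<close>

lemma almost_open_comeagre:
  assumes X: "completely_metrizable_space X" "second_countable X"
    and Y: "Hausdorff_space Y" "topspace Y = topspace X"
    and coarser: "\<And>U. openin Y U \<Longrightarrow> openin X U"
    and almost_open: "\<And>U. openin X U \<Longrightarrow> U \<subseteq> Y interior_of (Y closure_of U)"
    and V: "openin X V"
  shows "\<exists>\<G>. countable \<G> \<and> (\<forall>F\<in>\<G>. closedin Y F \<and> Y interior_of F = {}) \<and>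
           Y interior_of (Y closure_of V) \<subseteq> V \<union> \<Union>\<G>"
proof -
  obtain M d where "Metric_space M d" and mc: "Metric_space.mcomplete M d"
    and XM: "X = Metric_space.mtopology M d"
    using X(1) unfolding completely_metrizable_space_def by blast
  interpret Metric_space M d by fact
  obtain \<B>0 where \<B>0: "countable \<B>0" "\<And>B. B \<in> \<B>0 \<Longrightarrow> openin X B"
    "\<And>U x. openin X U \<Longrightarrow> x \<in> U \<Longrightarrow> \<exists>B\<in>\<B>0. x \<in> B \<and> B \<subseteq> U"
    using X(2)[unfolded second_countable_def] by metis
  \<comment> \<open>Adding \<open>V\<close> lets the sequence below start at \<open>V\<close> while
    all its terms come from one countable family.\<close>
  define \<B> where "\<B> = insert V \<B>0"
  have \<B>: "countable \<B>" "\<And>B. B \<in> \<B> \<Longrightarrow> openin X B" "V \<in> \<B>"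
    using \<B>0 V by (auto simp: \<B>_def)
  define E where "E U = Y interior_of (Y closure_of U)" for U
  \<comment> \<open>The admissible successors of \<open>U\<close> at stage \<open>k\<close> of the
    shrinking sequence.\<close>
  define \<F> where "\<F> U k = {B \<in> \<B>. X closure_of B \<subseteq> U \<and> (\<exists>a. B \<subseteq> mball a (1 / Suc k))}" for U and k :: nat
  \<comment> \<open>The boundary of an open set of \<open>Y\<close>, hence closed with empty
    interior. A point of \<open>E U\<close> that avoids it lies in \<open>E B\<close> for some
    successor \<open>B\<close> of \<open>U\<close>.\<close>
  define F where "F U k = Y closure_of (\<Union>(E ` \<F> U k)) - \<Union>(E ` \<F> U k)" for U k
  let ?\<G> = "(\<lambda>(U, k). F U k) ` (\<B> \<times> UNIV)"
  have openE: "openin Y (\<Union>(E ` \<F> U k))" for U k by (auto simp: E_def)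
  have "countable ?\<G>" using \<B> by auto
  moreover have "closedin Y (F U k)" for U k
    unfolding F_def by (intro closedin_diff openE) auto
  moreover have "Y interior_of (F U k) = {}" for U k
  proof -
    let ?I = "Y interior_of (F U k)"
    have "?I \<subseteq> F U k" by (rule interior_of_subset)
    then have "?I \<inter> \<Union>(E ` \<F> U k) = {}" "?I \<subseteq> Y closure_of (\<Union>(E ` \<F> U k))"
      unfolding F_def by blast+
    then show ?thesis
      by (metis Int_commute inf.orderE openin_Int_closure_of_eq_empty openin_interior_of)
  qed
  moreover have "y \<in> V" if y: "y \<in> E V" "y \<notin> \<Union>?\<G>" for y
  proof -
    have cover: "U \<subseteq> \<Union>(\<F> U k)" if U: "U \<in> \<B>" for U k
    proof
      fix x assume x: "x \<in> U"
      have xM: "x \<in> M" using \<B>(2)[OF U] x openin_subset XM by fastforce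
      obtain r where r: "r > 0" "mcball x r \<subseteq> U"
        using \<B>(2)[OF U] x XM openin_mtopology_mcball by metis
      define s where "s = min r (1 / Suc k)"
      have s: "s > 0" using r by (simp add: s_def)
      obtain B where B: "B \<in> \<B>0" "x \<in> B" "B \<subseteq> mball x s"
        using \<B>0(3)[of "mball x s" x] xM s XM by auto
      have "X closure_of B \<subseteq> mcball x s"
        unfolding XM by (rule closure_of_minimal) (use B mball_subset_mcball in auto)
      also have "\<dots> \<subseteq> U" using r mcball_subset_concentric[of s r x] by (auto simp: s_def)
      finally have "B \<in> \<F> U k"
        using B mball_subset_concentric[of s "1 / Suc k" x] by (auto simp: \<F>_def \<B>_def s_def)
      then show "x \<in> \<Union>(\<F> U k)" using B by auto
    qed
    have step: "\<exists>B. B \<in> \<F> U k \<and> y \<in> E B" if U: "U \<in> \<B>" "y \<in> E U" for U k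
    proof -
      \<comment> \<open>By almost openness each successor \<open>B\<close> lies in
        \<open>E B\<close>. The successors cover \<open>U\<close>, so \<open>Y closure_of U\<close>
        lies in the closure of the union of the sets \<open>E B\<close>.\<close>
      have "\<Union>(\<F> U k) \<subseteq> \<Union>(E ` \<F> U k)"
      proof (rule Union_least)
        fix B assume B: "B \<in> \<F> U k"
        then have "B \<subseteq> E B" unfolding E_def \<F>_def using almost_open \<B>(2) by simp
        then show "B \<subseteq> \<Union>(E ` \<F> U k)" using B by blast
      qed
      with cover[OF U(1), of k] have "Y closure_of U \<subseteq> Y closure_of (\<Union>(E ` \<F> U k))"
        by (intro closure_of_mono) auto
      then have "y \<in> Y closure_of (\<Union>(E ` \<F> U k))"
        using U(2) interior_of_subset[of Y "Y closure_of U"] by (auto simp: E_def)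
      moreover have "y \<notin> F U k" using y(2) U(1) by auto
      ultimately show ?thesis by (auto simp: F_def)
    qed
    \<comment> \<open>The clause for \<open>n = 0\<close> pins the start to \<open>V\<close>:
      dependent choice passes on only a property of each stage.\<close>
    have "\<exists>f. \<forall>n. (f n \<in> \<B> \<and> y \<in> E (f n) \<and> (n = 0 \<longrightarrow> f n = V)) \<and> f (Suc n) \<in> \<F> (f n) n"
    proof (rule dependent_nat_choice)
      show "\<exists>B. B \<in> \<B> \<and> y \<in> E B \<and> ((0::nat) = 0 \<longrightarrow> B = V)" using \<B>(3) y(1) by blast
      fix U and n :: nat assume "U \<in> \<B> \<and> y \<in> E U \<and> (n = 0 \<longrightarrow> U = V)"
      then obtain B where "B \<in> \<F> U n" "y \<in> E B" using step by blast
      then show "\<exists>B. (B \<in> \<B> \<and> y \<in> E B \<and> (Suc n = 0 \<longrightarrow> B = V)) \<and> B \<in> \<F> U n"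
        unfolding \<F>_def by blast
    qed
    then obtain f where f: "f 0 = V" "\<And>n. f n \<in> \<B>" "\<And>n. y \<in> E (f n)" "\<And>n. f (Suc n) \<in> \<F> (f n) n"
      by metis
    have ycl: "y \<in> Y closure_of f n" for n using f(3)[of n] interior_of_subset[of Y "Y closure_of f n"] by (auto simp: E_def)
    \<comment> \<open>Closed sets are needed for completeness to yield a common point;
      \<open>C n\<close> is squeezed between \<open>f (Suc n)\<close> and
      \<open>f n\<close>.\<close>
    define C where "C n = X closure_of f (Suc n)" for n
    have C1: "C n \<subseteq> f n" for n using f(4) by (auto simp: C_def \<F>_def)
    have C2: "f (Suc n) \<subseteq> C n" for n
      unfolding C_def by (rule closure_of_subset) (use \<B>(2) f(2) openin_subset in blast)
    have small: "\<exists>a. C n \<subseteq> mcball a (1 / Suc n)" for n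
    proof -
      obtain a where "f (Suc n) \<subseteq> mball a (1 / Suc n)" using f(4)[of n] by (auto simp: \<F>_def)
      then have "C n \<subseteq> mcball a (1 / Suc n)"
        unfolding C_def XM by (intro closure_of_minimal) (use mball_subset_mcball in auto)
      then show ?thesis ..
    qed
    have "\<Inter>(range C) \<noteq> {}"
    proof (rule mc[unfolded mcomplete_nest, rule_format], intro conjI allI impI)
      show "closedin mtopology (C n)" for n by (simp add: C_def XM)
      show "C n \<noteq> {}" for n using ycl[of "Suc n"] C2[of n] by (metis closure_of_empty empty_iff subset_empty)
      show "decseq C" by (intro decseq_SucI) (use C1 C2 in blast)
      fix e :: real assume e: "e > 0"
      then obtain n where "1 / real (Suc n) < e" using nat_approx_posE by blast
      then show "\<exists>n a. C n \<subseteq> mcball a e"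
        using small[of n] mcball_subset_concentric[of "1 / Suc n" e] by (meson less_imp_le order_trans)
    qed
    then obtain x where x: "\<And>n. x \<in> C n" by auto
    have "x \<in> V" using x[of 0] C1[of 0] f(1) by auto
    \<comment> \<open>For large \<open>n\<close> the set \<open>f (Suc n)\<close> lies in an
      \<open>X\<close>-ball inside \<open>O1\<close>, because \<open>Y\<close> is coarser. As
      \<open>y\<close> is in its \<open>Y\<close>-closure, it would have to meet the disjoint set
      \<open>O2\<close>.\<close>
    moreover have "x = y"
    proof (rule ccontr)
      assume neq: "x \<noteq> y"
      have "x \<in> topspace Y" "y \<in> topspace Y"
        using x[of 0] ycl[of 0] closure_of_subset_topspace[of Y] closure_of_subset_topspace[of X] Y(2)
        by (auto simp: C_def)
      then obtain O1 O2 where O: "openin Y O1" "openin Y O2" "x \<in> O1" "y \<in> O2" "disjnt O1 O2"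
        using Y(1) neq unfolding Hausdorff_space_def by metis
      obtain r where r: "r > 0" "mball x r \<subseteq> O1"
        using coarser[OF O(1)] O(3) XM openin_mtopology by metis
      obtain n where n: "1 / real (Suc n) < r / 2" using nat_approx_posE[of "r / 2"] r by auto
      obtain a where a: "C n \<subseteq> mcball a (1 / Suc n)" using small by blast
      have "f (Suc n) \<subseteq> mball x r"
      proof
        fix z assume "z \<in> f (Suc n)"
        then have z: "z \<in> mcball a (1 / Suc n)" using C2 a by blast
        have xa: "x \<in> mcball a (1 / Suc n)" using x a by blast
        show "z \<in> mball x r" using z xa n triangle[of x a z] by (auto simp: commute)
      qed
      then have "f (Suc n) \<inter> O2 = {}" using r O(5) by (auto simp: disjnt_def)
      then show False using ycl[of "Suc n"] O(2,4) by (auto simp: in_closure_of)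
    qed
    ultimately show ?thesis by simp
  qed
  ultimately show ?thesis
    by (intro exI[of _ ?\<G>]) (auto simp: E_def)
qed

section \<open>The open mapping argument for comparable group topologies\<close>

context topgroup
begin

text \<open>What has to be shown is that the identity from \<open>S\<close> to \<open>T\<close> is
  open. Covering by translates gives this up to closures (\<open>almost_open\<close>); then
  \<open>almost_open_comeagre\<close> gives it up to a meagre set, and a set meeting its translate
  gives it at the identity (\<open>nhd\<close>).\<close>

lemma finer_polish_topology_eq:
  assumes S: "polish_group G S" and T: "completely_metrizable_space T"
    and finer: "\<And>U. openin T U \<Longrightarrow> openin S U"
  shows "S = T"
proof -
  interpret S: topgroup G S using S by unfold_locales (simp add: polish_group_def)
  have Sp: "completely_metrizable_space S" "separable_space S" using S by (auto simp: polish_group_def)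
  \<comment> \<open>Continuity of \<open>f\<close> on the diagonal, used for the two words
    \<open>(x \<otimes> inv w) \<otimes> w'\<close> and \<open>w \<otimes> inv w'\<close>.\<close>
  have small_diff: "\<exists>W. openin S W \<and> x \<in> W \<and> (\<forall>w\<in>W. \<forall>w'\<in>W. f w w' \<in> V)"
    if V: "openin S V" "x \<in> carrier G" "f x x \<in> V"
      and f: "continuous_map (prod_topology S S) S (\<lambda>z. f (fst z) (snd z))" for V x and f :: "'a \<Rightarrow> 'a \<Rightarrow> 'a"
  proof -
    have "openin (prod_topology S S) {z \<in> topspace (prod_topology S S). f (fst z) (snd z) \<in> V}"
      by (rule openin_continuous_map_preimage[OF f V(1)])
    then obtain W1 W2 where "openin S W1" "openin S W2" "x \<in> W1" "x \<in> W2"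
      "W1 \<times> W2 \<subseteq> {z \<in> topspace (prod_topology S S). f (fst z) (snd z) \<in> V}"
      using V unfolding openin_prod_topology_alt by (fastforce simp: S.topspace_eq)
    then show ?thesis by (intro exI[of _ "W1 \<inter> W2"]) auto
  qed
  note cont = S.continuous_map_mult S.continuous_map_inv continuous_map_fst continuous_map_snd S.continuous_map_constant
  have almost_open: "V \<subseteq> T interior_of (T closure_of V)" if V: "openin S V" for V
  proof
    fix x assume x: "x \<in> V"
    have xG: "x \<in> carrier G" using V x openin_subset S.topspace_eq by blast
    have "\<exists>W. openin S W \<and> \<one> \<in> W \<and> (\<forall>w\<in>W. \<forall>w'\<in>W. (x \<otimes> inv w) \<otimes> w' \<in> V)"
      using V x xG by (intro small_diff cont) auto
    then obtain W where W: "openin S W" "\<one> \<in> W" "\<And>w w'. w \<in> W \<Longrightarrow> w' \<in> W \<Longrightarrow> (x \<otimes> inv w) \<otimes> w' \<in> V"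
      by blast
    have WG: "W \<subseteq> carrier G" using W(1) openin_subset S.topspace_eq by blast
    obtain C where C: "countable C" "C \<subseteq> carrier G" "S closure_of C = carrier G"
      using Sp(2) unfolding separable_space_def S.topspace_eq by blast
    \<comment> \<open>These countably many \<open>T\<close>-closed sets cover the group because
      \<open>C\<close> is dense for \<open>S\<close> and \<open>W\<close> is an
      \<open>S\<close>-neighbourhood of the identity. Baire category is then applied to
      \<open>T\<close>, so one of them has interior.\<close>
    let ?\<G> = "(\<lambda>c. c <# (T closure_of W)) ` C"
    have cl_coset: "T closure_of (c <# W) = c <# (T closure_of W)" if "c \<in> carrier G" for c
      unfolding l_coset_image
      by (rule homeomorphic_map_closure_of[OF homeomorphic_map_lmult[OF that]]) (simp add: WG topspace_eq)
    have int_coset: "T interior_of (c <# (T closure_of W)) = c <# (T interior_of (T closure_of W))" if "c \<in> carrier G" for c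
      unfolding l_coset_image
      by (intro homeomorphic_map_interior_of[OF homeomorphic_map_lmult[OF that]] closure_of_subset_topspace)
    have "\<Union>?\<G> = topspace T"
    proof (intro equalityI subsetI)
      fix g assume g: "g \<in> topspace T"
      then have gG: "g \<in> carrier G" by (simp add: topspace_eq)
      have "continuous_map S S (\<lambda>y. inv y \<otimes> g)"
        by (intro cont continuous_map_id[unfolded id_def] gG)
      then have "openin S {y \<in> topspace S. inv y \<otimes> g \<in> W}"
        by (rule openin_continuous_map_preimage[OF _ W(1)])
      moreover have "g \<in> {y \<in> topspace S. inv y \<otimes> g \<in> W}" using gG W(2) by (simp add: S.topspace_eq)
      moreover have "g \<in> S closure_of C" using gG C by simp
      ultimately obtain c where c: "c \<in> C" "inv c \<otimes> g \<in> W"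
        unfolding in_closure_of by (smt (verit) mem_Collect_eq)
      have "g \<in> c <# W" using c C WG gG by (auto simp: l_coset_mem_iff subsetD)
      moreover have "W \<subseteq> T closure_of W" by (simp add: closure_of_subset WG topspace_eq)
      ultimately show "g \<in> \<Union>?\<G>" using c(1) by (auto simp: l_coset_def)
    next
      fix g assume "g \<in> \<Union>?\<G>"
      then show "g \<in> topspace T"
        using C(2) closure_of_subset_topspace[of T W] by (auto simp: l_coset_def topspace_eq subsetD)
    qed
    then have "T interior_of \<Union>?\<G> \<noteq> {}" using xG topspace_eq interior_of_topspace[of T] by auto
    moreover have "T interior_of \<Union>?\<G> = {}" if "\<And>c. c \<in> C \<Longrightarrow> T interior_of (c <# (T closure_of W)) = {}"
      using that T C(1,2) by (intro Baire_category_alt) (auto intro!: closedin_l_coset)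
    ultimately obtain c where "c \<in> C" "T interior_of (c <# (T closure_of W)) \<noteq> {}" by blast
    then have "c <# (T interior_of (T closure_of W)) \<noteq> {}" using int_coset C(2) by blast
    then have "T interior_of (T closure_of W) \<noteq> {}" by (auto simp: l_coset_def)
    then have "T interior_of (T closure_of W) \<inter> T closure_of W \<noteq> {}"
      using interior_of_subset[of T "T closure_of W"] by blast
    then have "T interior_of (T closure_of W) \<inter> W \<noteq> {}"
      by (simp add: openin_Int_closure_of_eq_empty)
    then obtain w where w: "w \<in> W" "w \<in> T interior_of (T closure_of W)" by blast
    \<comment> \<open>Translation by \<open>?a\<close> moves the interior point \<open>w\<close> to
      \<open>x\<close> and, by the choice of \<open>W\<close>, keeps \<open>?a <# W\<close> inside
      \<open>V\<close>.\<close>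
    let ?a = "x \<otimes> inv w"
    have a: "?a \<in> carrier G" using xG w WG by auto
    have "x = ?a \<otimes> w" using xG w WG by (auto simp: m_assoc subsetD)
    then have "x \<in> T interior_of (?a <# (T closure_of W))"
      unfolding int_coset[OF a] using w by (auto simp: l_coset_def)
    moreover have "?a <# W \<subseteq> V" using W(3)[OF w(1)] by (auto simp: l_coset_def)
    then have "?a <# (T closure_of W) \<subseteq> T closure_of V"
      unfolding cl_coset[OF a, symmetric] by (rule closure_of_mono)
    ultimately show "x \<in> T interior_of (T closure_of V)"
      using interior_of_mono by blast
  qed
  have nhd: "\<exists>U. openin T U \<and> \<one> \<in> U \<and> U \<subseteq> V" if V: "openin S V" "\<one> \<in> V" for V
  proof -
    have "\<exists>W. openin S W \<and> \<one> \<in> W \<and> (\<forall>w\<in>W. \<forall>w'\<in>W. w \<otimes> inv w' \<in> V)"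
      using V by (intro small_diff cont) auto
    then obtain W where W: "openin S W" "\<one> \<in> W" "\<And>w w'. w \<in> W \<Longrightarrow> w' \<in> W \<Longrightarrow> w \<otimes> inv w' \<in> V"
      by blast
    let ?E = "T interior_of (T closure_of W)"
    have "\<exists>\<G>. countable \<G> \<and> (\<forall>F\<in>\<G>. closedin T F \<and> T interior_of F = {}) \<and>
           T interior_of (T closure_of W) \<subseteq> W \<union> \<Union>\<G>"
    proof (rule almost_open_comeagre[OF Sp(1)])
      show "second_countable S"
        using Sp completely_metrizable_imp_metrizable_space metrizable_separable_imp_second_countable by blast
      show "Hausdorff_space T"
        using T completely_metrizable_imp_metrizable_space metrizable_imp_Hausdorff_space by blast
    qed (simp_all add: finer almost_open W(1) topspace_eq S.topspace_eq)
    then obtain \<G> where \<G>: "countable \<G>" "\<And>F. F \<in> \<G> \<Longrightarrow> closedin T F" "\<And>F. F \<in> \<G> \<Longrightarrow> T interior_of F = {}"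
      "?E \<subseteq> W \<union> \<Union>\<G>"
      by metis
    \<comment> \<open>Both \<open>?E\<close> and \<open>h <# ?E\<close> are open around
      \<open>h\<close>, and up to meagre sets they lie in \<open>W\<close> and
      \<open>h <# W\<close>. So there is a point \<open>z = h \<otimes> e\<close> with
      \<open>z\<close> and \<open>e\<close> in \<open>W\<close>, and
      \<open>h = z \<otimes> inv e\<close> is in \<open>V\<close>.\<close>
    have "h \<in> V" if h: "h \<in> ?E" for h
    proof -
      have hG: "h \<in> carrier G" using h interior_of_subset_topspace[of T] topspace_eq by blast
      let ?\<H> = "\<G> \<union> (\<lambda>F. h <# F) ` \<G>"
      have "T interior_of \<Union>?\<H> = {}"
      proof (rule Baire_category_alt)
        show "completely_metrizable_space T \<or> locally_compact_space T \<and> regular_space T" using T by simp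
        show "countable ?\<H>" using \<G> by auto
        fix F assume "F \<in> ?\<H>"
        moreover have "T interior_of (h <# F) = {}" if "F \<in> \<G>" for F
        proof -
          have "T interior_of (h <# F) = h <# (T interior_of F)"
            unfolding l_coset_image
            by (rule homeomorphic_map_interior_of[OF homeomorphic_map_lmult[OF hG]])
               (use \<G>(2)[OF that] closedin_subset in auto)
          then show ?thesis using \<G>(3)[OF that] by (simp add: l_coset_def)
        qed
        ultimately show "closedin T F \<and> T interior_of F = {}"
          using \<G>(2,3) closedin_l_coset[OF hG] by auto
      qed
      moreover have "openin T (?E \<inter> (h <# ?E))" by (intro openin_Int openin_l_coset hG openin_interior_of)
      moreover have "\<one> \<in> ?E" using almost_open[OF W(1)] W(2) by blast
      then have "h \<in> ?E \<inter> (h <# ?E)" using h hG by (force simp: l_coset_def)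
      ultimately obtain z where z: "z \<in> ?E" "z \<in> h <# ?E" "z \<notin> \<Union>?\<H>"
        using interior_of_maximal[of "?E \<inter> (h <# ?E)" "\<Union>?\<H>" T] by blast
      then obtain e where e: "e \<in> ?E" "z = h \<otimes> e" by (auto simp: l_coset_def)
      have "z \<in> W" using z \<G>(4) by auto
      moreover have "e \<in> W" using e z(3) \<G>(4) by (auto simp: l_coset_def)
      ultimately have "z \<otimes> inv e \<in> V" by (rule W(3))
      moreover have "e \<in> carrier G" using e interior_of_subset_topspace[of T] topspace_eq by blast
      ultimately show ?thesis using e hG by (simp add: m_assoc)
    qed
    then show ?thesis
      using almost_open[OF W(1)] W(2) by (intro exI[of _ ?E]) auto
  qed
  have "openin T V" if V: "openin S V" for V
  proof (subst openin_subopen, intro ballI)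
    fix x assume x: "x \<in> V"
    have VG: "V \<subseteq> carrier G" using V openin_subset S.topspace_eq by blast
    have xG: "x \<in> carrier G" using VG x by blast
    have "\<one> \<in> inv x <# V" using xG x VG by (subst l_coset_mem_iff) auto
    then obtain U where U: "openin T U" "\<one> \<in> U" "U \<subseteq> inv x <# V"
      using nhd[OF S.openin_l_coset[OF inv_closed[OF xG] V]] by blast
    have "x <# U \<subseteq> x <# (inv x <# V)" using U(3) by (auto simp: l_coset_def)
    also have "\<dots> = V" using xG VG by (simp add: lcos_m_assoc lcos_mult_one)
    finally have "x <# U \<subseteq> V" .
    moreover have "x \<in> x <# U"
      using xG U openin_subset[OF U(1)] by (subst l_coset_mem_iff) (auto simp: topspace_eq)
    ultimately show "\<exists>U. openin T U \<and> x \<in> U \<and> U \<subseteq> V"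
      using openin_l_coset[OF xG U(1)] by blast
  qed
  then show ?thesis unfolding topology_eq using finer by blast
qed

end

section \<open>The group of permutations of the natural numbers\<close>

lemma group_Sinf: "group Sinf"
  by (simp add: Sinf_def group_BijGroup)

lemma carrier_Sinf: "carrier Sinf = {f. bij f}"
  by (simp add: Sinf_def BijGroup_def Bij_def)

lemma mult_Sinf: "bij f \<Longrightarrow> bij g \<Longrightarrow> f \<otimes>\<^bsub>Sinf\<^esub> g = f \<circ> g"
  by (simp add: Sinf_def BijGroup_def Bij_def compose_def o_def restrict_def)

lemma one_Sinf: "\<one>\<^bsub>Sinf\<^esub> = id"
  by (simp add: Sinf_def BijGroup_def id_def restrict_def)

lemma inv_Sinf: "bij f \<Longrightarrow> inv\<^bsub>Sinf\<^esub> f = inv_into UNIV f"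
  by (simp add: Sinf_def inv_BijGroup Bij_def restrict_def)

lemma topspace_Sinf_top: "topspace Sinf_top = carrier Sinf"
  by (simp add: Sinf_top_def)

abbreviation nat_fun_top :: "(nat \<Rightarrow> nat) topology" where
  "nat_fun_top \<equiv> product_topology (\<lambda>_. discrete_topology UNIV) UNIV"

lemma openin_nat_fun_top_eval: "openin nat_fun_top {f. P (f n)}"
proof -
  have "continuous_map nat_fun_top (discrete_topology UNIV) (\<lambda>f. f n)"
    by (rule continuous_map_product_projection) simp
  then have "openin nat_fun_top {f \<in> topspace nat_fun_top. f n \<in> {k. P k}}"
    by (rule openin_continuous_map_preimage) simp
  then show ?thesis by simp
qed

lemma openin_Sinf_top_eval: "openin Sinf_top {f \<in> carrier Sinf. f n = m}"
  unfolding Sinf_top_def openin_subtopology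
  using openin_nat_fun_top_eval[of "\<lambda>k. k = m" n] by (intro exI[of _ "{f. f n = m}"]) auto

text \<open>A basic open set of the product constrains only finitely many coordinates;
  \<open>F\<close> collects them.\<close>

lemma openin_Sinf_top_finite:
  assumes "openin Sinf_top U" "f \<in> U"
  obtains F where "finite F" "\<And>g. g \<in> carrier Sinf \<Longrightarrow> (\<And>n. n \<in> F \<Longrightarrow> g n = f n) \<Longrightarrow> g \<in> U"
proof -
  obtain V where V: "openin nat_fun_top V" "U = V \<inter> carrier Sinf"
    using assms(1) unfolding Sinf_top_def openin_subtopology by blast
  obtain W where W: "finite {i. W i \<noteq> UNIV}" "f \<in> (\<Pi>\<^sub>E i\<in>UNIV. W i)" "(\<Pi>\<^sub>E i\<in>UNIV. W i) \<subseteq> V"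
    using product_topology_open_contains_basis[OF V(1), of f] assms(2) V(2) by auto
  show thesis
  proof (rule that[OF W(1)])
    fix g assume g: "g \<in> carrier Sinf" "\<And>n. n \<in> {i. W i \<noteq> UNIV} \<Longrightarrow> g n = f n"
    have "g n \<in> W n" for n using g(2)[of n] W(2) by (cases "W n = UNIV") auto
    then show "g \<in> U" using W(3) g(1) V(2) by auto
  qed
qed

text \<open>As \<open>nat\<close> is discrete, preimages of single values of single evaluations are
  enough. Continuity of \<open>\<theta>\<close>, and of \<open>\<Gamma>\<close> after
  \<open>\<Psi>\<close>, is checked in this form.\<close>

lemma continuous_map_into_Sinf:
  assumes "\<And>x. x \<in> topspace X \<Longrightarrow> f x \<in> carrier Sinf"
    and "\<And>n m. openin X {x \<in> topspace X. f x n = m}"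
  shows "continuous_map X Sinf_top f"
proof -
  have "continuous_map X (discrete_topology UNIV) (\<lambda>x. f x n)" for n
    unfolding continuous_map_def
  proof (intro conjI allI impI)
    fix U :: "nat set"
    have "{x \<in> topspace X. f x n \<in> U} = (\<Union>m\<in>U. {x \<in> topspace X. f x n = m})" by auto
    then show "openin X {x \<in> topspace X. f x n \<in> U}" using assms(2) by auto
  qed auto
  then show ?thesis
    unfolding Sinf_top_def continuous_map_in_subtopology
    using assms(1) by (auto intro: continuous_map_coordinatewise_then_product)
qed

lemma continuous_map_from_Sinf:
  assumes "continuous_map X Sinf_top f"
  shows "openin X {x \<in> topspace X. f x n = m}"
proof -
  have "openin X {x \<in> topspace X. f x \<in> {f \<in> carrier Sinf. f n = m}}"
    using assms openin_Sinf_top_eval by (rule openin_continuous_map_preimage)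
  moreover have "f x \<in> carrier Sinf" if "x \<in> topspace X" for x
    using continuous_map_image_subset_topspace[OF assms] that topspace_Sinf_top by auto
  ultimately show ?thesis by (simp cong: conj_cong)
qed

lemma topological_group_Sinf: "topological_group Sinf Sinf_top"
proof -
  interpret group Sinf by (rule group_Sinf)
  have "continuous_map (prod_topology Sinf_top Sinf_top) Sinf_top (\<lambda>z. fst z \<otimes>\<^bsub>Sinf\<^esub> snd z)"
  proof (rule continuous_map_into_Sinf)
    fix n m
    have fst: "continuous_map (prod_topology Sinf_top Sinf_top) Sinf_top fst"
      and snd: "continuous_map (prod_topology Sinf_top Sinf_top) Sinf_top snd"
      by (rule continuous_map_fst continuous_map_snd)+
    let ?P = "topspace (prod_topology Sinf_top Sinf_top)"
    \<comment> \<open>Splitting by the intermediate value \<open>k\<close> leaves conditions on one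
      coordinate of each factor.\<close>
    have "{z \<in> ?P. (fst z \<otimes>\<^bsub>Sinf\<^esub> snd z) n = m} =
        (\<Union>k. {z \<in> ?P. snd z n = k} \<inter> {z \<in> ?P. fst z k = m})"
      by (auto simp: topspace_Sinf_top carrier_Sinf mult_Sinf)
    moreover have "openin (prod_topology Sinf_top Sinf_top) \<dots>"
      by (intro openin_Union) (auto intro!: openin_Int continuous_map_from_Sinf fst snd
         simp del: topspace_prod_topology)
    ultimately show "openin (prod_topology Sinf_top Sinf_top) {z \<in> ?P. (fst z \<otimes>\<^bsub>Sinf\<^esub> snd z) n = m}"
      by simp
  qed (auto simp: topspace_Sinf_top)
  moreover have "continuous_map Sinf_top Sinf_top (\<lambda>x. inv\<^bsub>Sinf\<^esub> x)"
  proof (rule continuous_map_into_Sinf)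
    fix n m
    have "{f \<in> topspace Sinf_top. (inv\<^bsub>Sinf\<^esub> f) n = m} = {f \<in> carrier Sinf. f m = n}"
      by (auto simp: topspace_Sinf_top carrier_Sinf inv_Sinf bij_is_surj bij_is_inj surj_f_inv_f)
    then show "openin Sinf_top {f \<in> topspace Sinf_top. (inv\<^bsub>Sinf\<^esub> f) n = m}"
      using openin_Sinf_top_eval by simp
  qed (simp add: topspace_Sinf_top)
  ultimately show ?thesis
    unfolding topological_group_def by (simp add: group_Sinf topspace_Sinf_top case_prod_unfold)
qed

lemma second_countable_Sinf_top: "second_countable Sinf_top"
proof -
  have "discrete_topology (UNIV :: nat set) = euclidean"
    by (simp add: topology_eq open_discrete)
  then have "nat_fun_top = (euclidean :: (nat \<Rightarrow> nat) topology)"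
    by (simp add: euclidean_product_topology)
  moreover have "second_countable (euclidean :: (nat \<Rightarrow> nat) topology)"
  proof -
    obtain B :: "(nat \<Rightarrow> nat) set set" where "countable B" "topological_basis B"
      using ex_countable_basis by blast
    then show ?thesis
      unfolding second_countable_def
      by (metis open_openin topological_basisE topological_basis_open)
  qed
  ultimately show ?thesis by (simp add: Sinf_top_def second_countable_subtopology)
qed

text \<open>Injectivity and surjectivity are countable families of open conditions on a function
  (\<open>D\<close> and \<open>R\<close>), so the bijections form a G-delta in a completely
  metrizable product.\<close>

lemma completely_metrizable_Sinf_top: "completely_metrizable_space Sinf_top"
proof -
  have "completely_metrizable_space nat_fun_top"
    by (simp add: completely_metrizable_space_product_topology completely_metrizable_space_discrete_topology)
  moreover have "(countable intersection_of openin nat_fun_top) (carrier Sinf)"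
  proof -
    \<comment> \<open>The disjunct \<open>i = j\<close> lets all pairs serve as indices.\<close>
    define D where "D = (\<lambda>(i, j). {f :: nat \<Rightarrow> nat. i = j \<or> f i \<noteq> f j})"
    define R where "R n = {f :: nat \<Rightarrow> nat. \<exists>m. f m = n}" for n
    have "openin nat_fun_top (D (i, j))" for i j
    proof -
      have "D (i, j) = (\<Union>k. {f. f i = k} \<inter> {f. i = j \<or> f j \<noteq> k})" by (auto simp: D_def)
      moreover have "openin nat_fun_top \<dots>"
        by (intro openin_Union) (auto intro!: openin_Int openin_nat_fun_top_eval)
      ultimately show ?thesis by simp
    qed
    then have "openin nat_fun_top (D p)" for p by (cases p) simp
    moreover have "openin nat_fun_top (R n)" for n
    proof -
      have "R n = (\<Union>m. {f. f m = n})" by (auto simp: R_def)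
      moreover have "openin nat_fun_top \<dots>"
        by (intro openin_Union) (auto intro!: openin_nat_fun_top_eval)
      ultimately show ?thesis by simp
    qed
    moreover have "carrier Sinf = \<Inter>(range D \<union> range R)"
    proof (intro equalityI subsetI)
      fix f assume "f \<in> carrier Sinf"
      then have "inj f" "surj f" by (simp_all add: carrier_Sinf bij_def)
      then have "f \<in> D p" "f \<in> R n" for p n
        using surjD[OF \<open>surj f\<close>, of n] by (auto simp: D_def R_def inj_eq split: prod.split)
      then show "f \<in> \<Inter>(range D \<union> range R)" by blast
    next
      fix f assume "f \<in> \<Inter>(range D \<union> range R)"
      then have "f \<in> D (i, j)" "f \<in> R n" for i j n by blast+
      then have "inj f" "surj f"
        unfolding inj_def surj_def D_def R_def by simp_all metis+
      then show "f \<in> carrier Sinf" by (simp add: carrier_Sinf bij_def)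
    qed
    ultimately show ?thesis
      unfolding intersection_of_def by (intro exI[of _ "range D \<union> range R"]) auto
  qed
  ultimately show ?thesis
    unfolding Sinf_top_def by (rule completely_metrizable_space_gdelta_in_alt)
qed

interpretation Sinf: topgroup Sinf Sinf_top
  by unfold_locales (rule topological_group_Sinf)

section \<open>Normalisers and topological automorphisms\<close>

text \<open>Equality of \<open>H\<close> with its conjugate is split into two inclusions, the second
  moved over by the inverse. For fixed \<open>h\<close> and closed \<open>H\<close> each becomes a
  closed condition on \<open>x\<close>.\<close>

lemma (in group) mem_normalizer_iff:
  assumes H: "H \<subseteq> carrier G"
  shows "x \<in> normalizer G H \<longleftrightarrow>
    x \<in> carrier G \<and> (\<forall>h\<in>H. x \<otimes> h \<otimes> inv x \<in> H) \<and> (\<forall>h\<in>H. inv x \<otimes> h \<otimes> x \<in> H)"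
proof -
  have "x <# H #> inv x = (\<lambda>h. x \<otimes> h \<otimes> inv x) ` H"
    by (auto simp: l_coset_def r_coset_def)
  moreover have "(\<lambda>h. x \<otimes> h \<otimes> inv x) ` H = H \<longleftrightarrow>
      (\<forall>h\<in>H. x \<otimes> h \<otimes> inv x \<in> H) \<and> (\<forall>h\<in>H. inv x \<otimes> h \<otimes> x \<in> H)" if x: "x \<in> carrier G"
  proof -
    have cancel: "inv x \<otimes> (x \<otimes> k) = k" "x \<otimes> (inv x \<otimes> k) = k" if "k \<in> carrier G" for k
      using x that by (simp_all flip: m_assoc)
    have eq1: "inv x \<otimes> (x \<otimes> h \<otimes> inv x) \<otimes> x = h" if "h \<in> H" for h
      using that H x by (simp add: m_assoc cancel subsetD)
    have eq2: "x \<otimes> (inv x \<otimes> h \<otimes> x) \<otimes> inv x = h" if "h \<in> H" for h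
      using that H x by (simp add: m_assoc cancel subsetD)
    show ?thesis
    proof (intro iffI conjI ballI)
      fix h assume *: "(\<lambda>h. x \<otimes> h \<otimes> inv x) ` H = H" and h: "h \<in> H"
      show "x \<otimes> h \<otimes> inv x \<in> H" using * h by blast
      obtain k where "k \<in> H" "h = x \<otimes> k \<otimes> inv x" using * h by blast
      then show "inv x \<otimes> h \<otimes> x \<in> H" using eq1 by simp
    next
      assume *: "(\<forall>h\<in>H. x \<otimes> h \<otimes> inv x \<in> H) \<and> (\<forall>h\<in>H. inv x \<otimes> h \<otimes> x \<in> H)"
      show "(\<lambda>h. x \<otimes> h \<otimes> inv x) ` H = H"
      proof (intro equalityI subsetI)
        fix h assume h: "h \<in> H"
        then show "h \<in> (\<lambda>h. x \<otimes> h \<otimes> inv x) ` H"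
          using eq2[OF h] * by (intro image_eqI[of _ _ "inv x \<otimes> h \<otimes> x"]) auto
      qed (use * in auto)
    qed
  qed
  ultimately show ?thesis
    using H unfolding normalizer_def stabilizer_def by auto
qed

lemma (in topgroup) closedin_normalizer:
  assumes H: "H \<subseteq> carrier G" "closedin T H"
  shows "closedin T (normalizer G H)"
proof (cases "H = {}")
  case True
  then show ?thesis using mem_normalizer_iff[of H] topspace_eq
    by (metis (no_types, lifting) closedin_topspace empty_iff empty_subsetI subset_antisym subsetI)
next
  case False
  note cont = continuous_map_mult continuous_map_inv continuous_map_id[unfolded id_def] continuous_map_constant
  \<comment> \<open>Nonemptiness keeps the intersection inside the carrier; over an empty index set
    it would be the whole type.\<close>
  have "normalizer G H = (\<Inter>h\<in>H. {x \<in> topspace T. x \<otimes> h \<otimes> inv x \<in> H} \<inter> {x \<in> topspace T. inv x \<otimes> h \<otimes> x \<in> H})"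
    using False mem_normalizer_iff[OF H(1)] by (auto simp: topspace_eq)
  also have "closedin T \<dots>"
    using False H by (intro closedin_INT closedin_Int closedin_continuous_map_preimage[OF _ H(2)] cont) auto
  finally show ?thesis .
qed

lemma (in group) l_coset_eq_iff:
  assumes U: "subgroup U G" and "a \<in> carrier G" "b \<in> carrier G"
  shows "a <# U = b <# U \<longleftrightarrow> inv b \<otimes> a \<in> U"
proof
  interpret U: subgroup U G by (rule U)
  assume "a <# U = b <# U"
  moreover have "a \<in> a <# U" using assms by (auto simp: l_coset_def intro: bexI[of _ \<one>])
  ultimately obtain u where "u \<in> U" "a = b \<otimes> u" by (auto simp: l_coset_def)
  then show "inv b \<otimes> a \<in> U" using assms by (simp flip: m_assoc)
next
  interpret U: subgroup U G by (rule U)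
  assume *: "inv b \<otimes> a \<in> U"
  have "a = b \<otimes> (inv b \<otimes> a)" using assms by (simp flip: m_assoc)
  then have "a \<in> b <# U" using * unfolding l_coset_def by blast
  then show "a <# U = b <# U" using assms by (metis l_repr_independence)
qed

lemma carrier_TopAut:
  "\<Phi> \<in> carrier (TopAut G T) \<longleftrightarrow>
     \<Phi> \<in> hom G G \<and> \<Phi> \<in> extensional (carrier G) \<and> bij_betw \<Phi> (carrier G) (carrier G) \<and> homeomorphic_map T T \<Phi>"
  by (auto simp: TopAut_def auto_def Bij_def)

lemma mult_TopAut:
  "\<Phi> \<in> carrier (TopAut G T) \<Longrightarrow> \<Phi>' \<in> carrier (TopAut G T) \<Longrightarrow>
     \<Phi> \<otimes>\<^bsub>TopAut G T\<^esub> \<Phi>' = compose (carrier G) \<Phi> \<Phi>'"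
  by (simp add: TopAut_def AutoGroup_def BijGroup_def auto_def)

lemma one_TopAut: "\<one>\<^bsub>TopAut G T\<^esub> = (\<lambda>x\<in>carrier G. x)"
  by (simp add: TopAut_def AutoGroup_def BijGroup_def)

context topgroup
begin

abbreviation Aut where "Aut \<equiv> TopAut G T"

text \<open>The set \<open>auto G\<close> is already a subgroup, so only the homeomorphism property
  is at stake. Since automorphisms are extensional, composites and inverses have to be compared with
  their restrictions to the carrier.\<close>

lemma subgroup_TopAut: "subgroup (carrier Aut) (BijGroup (carrier G))"
proof -
  interpret A: subgroup "auto G" "BijGroup (carrier G)" by (rule subgroup_auto)
  interpret B: group "BijGroup (carrier G)" by (rule group_BijGroup)
  have sub: "\<Phi> \<in> auto G" if "\<Phi> \<in> carrier Aut" for \<Phi> using that by (simp add: TopAut_def)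
  have homeo: "homeomorphic_map T T \<Phi>" if "\<Phi> \<in> carrier Aut" for \<Phi> using that by (simp add: TopAut_def)
  have Bij: "\<Phi> \<in> Bij (carrier G)" if "\<Phi> \<in> carrier Aut" for \<Phi> using sub[OF that] by (simp add: auto_def)
  show ?thesis
  proof (intro B.subgroupI)
    show "carrier Aut \<subseteq> carrier (BijGroup (carrier G))"
      using sub A.subset by blast
    have "homeomorphic_map T T (\<lambda>x\<in>carrier G. x)"
      by (rule homeomorphic_map_eq[of T T id]) (auto simp: topspace_eq)
    then show "carrier Aut \<noteq> {}"
      using id_in_auto by (force simp: TopAut_def)
    fix \<Phi> assume \<Phi>: "\<Phi> \<in> carrier Aut"
    obtain f where f: "homeomorphic_maps T T \<Phi> f" using homeo[OF \<Phi>] by (auto simp: homeomorphic_map_maps)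
    have f_eq: "f y = inv_into (carrier G) \<Phi> y" if "y \<in> topspace T" for y
    proof -
      have "f ` topspace T \<subseteq> topspace T"
        using f unfolding homeomorphic_maps_def by (metis continuous_map_image_subset_topspace)
      then have "f y \<in> carrier G" using that by (auto simp: topspace_eq)
      moreover have "\<Phi> (f y) = y" using f that by (simp add: homeomorphic_maps_def)
      ultimately show ?thesis using Bij[OF \<Phi>] by (metis Bij_def Int_iff bij_betw_def inv_into_f_f mem_Collect_eq)
    qed
    have "homeomorphic_map T T f" using f homeomorphic_maps_sym homeomorphic_maps_imp_map by blast
    then have "homeomorphic_map T T (\<lambda>y\<in>carrier G. inv_into (carrier G) \<Phi> y)"
      by (rule homeomorphic_map_eq) (simp add: f_eq flip: topspace_eq)
    then show "inv\<^bsub>BijGroup (carrier G)\<^esub> \<Phi> \<in> carrier Aut"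
      using A.m_inv_closed[OF sub[OF \<Phi>]] Bij[OF \<Phi>] by (simp add: TopAut_def inv_BijGroup)
    fix \<Phi>' assume \<Phi>': "\<Phi>' \<in> carrier Aut"
    have "homeomorphic_map T T (compose (carrier G) \<Phi> \<Phi>')"
      by (rule homeomorphic_map_eq[OF homeomorphic_map_compose[OF homeo[OF \<Phi>'] homeo[OF \<Phi>]]])
         (auto simp: topspace_eq compose_def)
    then show "\<Phi> \<otimes>\<^bsub>BijGroup (carrier G)\<^esub> \<Phi>' \<in> carrier Aut"
      using A.m_closed[OF sub[OF \<Phi>] sub[OF \<Phi>']] Bij[OF \<Phi>] Bij[OF \<Phi>']
      by (simp add: TopAut_def BijGroup_def)
  qed
qed

lemma TopAut_eq: "Aut = BijGroup (carrier G) \<lparr>carrier := carrier Aut\<rparr>"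
  by (simp add: TopAut_def AutoGroup_def)

lemma group_TopAut: "group Aut"
  using group.subgroup_imp_group[OF group_BijGroup subgroup_TopAut] by (metis TopAut_eq)

lemma inv_TopAut:
  assumes "\<Phi> \<in> carrier Aut"
  shows "inv\<^bsub>Aut\<^esub> \<Phi> = (\<lambda>x\<in>carrier G. inv_into (carrier G) \<Phi> x)"
  using group.m_inv_consistent[OF group_BijGroup subgroup_TopAut assms]
  by (metis TopAut_eq BijGroup_def assms inv_BijGroup partial_object.select_convs(1) subgroup.mem_carrier subgroup_TopAut)

lemma TopAut_mult: "\<Phi> \<in> carrier Aut \<Longrightarrow> x \<in> carrier G \<Longrightarrow> y \<in> carrier G \<Longrightarrow> \<Phi> (x \<otimes> y) = \<Phi> x \<otimes> \<Phi> y"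
  by (simp add: carrier_TopAut hom_def)

lemma TopAut_closed: "\<Phi> \<in> carrier Aut \<Longrightarrow> x \<in> carrier G \<Longrightarrow> \<Phi> x \<in> carrier G"
  by (auto simp: carrier_TopAut hom_def)

lemma inv_TopAut_apply:
  assumes "\<Phi> \<in> carrier Aut" "x \<in> carrier G"
  shows "(inv\<^bsub>Aut\<^esub> \<Phi>) (\<Phi> x) = x" "\<Phi> ((inv\<^bsub>Aut\<^esub> \<Phi>) x) = x"
  using assms by (auto simp: inv_TopAut carrier_TopAut bij_betw_def f_inv_into_f hom_in_carrier)

lemma TopAut_image_l_coset:
  assumes "\<Phi> \<in> carrier Aut" "g \<in> carrier G" "U \<subseteq> carrier G"
  shows "\<Phi> ` (g <# U) = \<Phi> g <# (\<Phi> ` U)"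
  using assms by (auto simp: l_coset_def TopAut_mult subsetD image_iff) 

lemma TopAut_mult_image:
  assumes "\<Phi> \<in> carrier Aut" "\<Phi>' \<in> carrier Aut" "A \<subseteq> carrier G"
  shows "(\<Phi> \<otimes>\<^bsub>Aut\<^esub> \<Phi>') ` A = \<Phi> ` (\<Phi>' ` A)"
  using assms by (force simp: mult_TopAut compose_def subset_iff image_iff)

text \<open>Inner automorphisms make the invariant family \<open>\<S>\<close> closed under
  conjugation, which turns right cosets into left cosets.\<close>

lemma inner_TopAut:
  assumes a: "a \<in> carrier G"
  shows "(\<lambda>x\<in>carrier G. a \<otimes> x \<otimes> inv a) \<in> carrier Aut"
proof -
  let ?c = "\<lambda>a. \<lambda>x\<in>carrier G. a \<otimes> x \<otimes> inv a"
  have cancel: "b \<otimes> (c \<otimes> x \<otimes> inv c) \<otimes> inv b = x"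
    if "b \<otimes> c = \<one>" "b \<in> carrier G" "c \<in> carrier G" "x \<in> carrier G" for b c x
  proof -
    have "b \<otimes> (c \<otimes> x \<otimes> inv c) \<otimes> inv b = (b \<otimes> c) \<otimes> x \<otimes> inv (b \<otimes> c)"
      using that(2-) by (simp add: m_assoc inv_mult_group)
    then show ?thesis using that by simp
  qed
  have cont: "continuous_map T T (?c b)" if "b \<in> carrier G" for b
    by (rule continuous_map_eq[of T T "\<lambda>x. b \<otimes> x \<otimes> inv b"])
       (use that in \<open>auto intro!: continuous_map_mult continuous_map_constant simp: topspace_eq\<close>)
  have inv: "?c (inv a) (?c a x) = x" "?c a (?c (inv a) x) = x" if "x \<in> carrier G" for x
    using cancel[of "inv a" a x] cancel[of a "inv a" x] a that by auto
  have "homeomorphic_maps T T (?c a) (?c (inv a))"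
    unfolding homeomorphic_maps_def topspace_eq
    using inv cont[OF a] cont[OF inv_closed[OF a]] by blast
  then have "homeomorphic_map T T (?c a)" by (rule homeomorphic_maps_imp_map)
  moreover have "?c a \<in> hom G G"
  proof (rule homI)
    fix x y assume xy: "x \<in> carrier G" "y \<in> carrier G"
    have "inv a \<otimes> (a \<otimes> (y \<otimes> inv a)) = y \<otimes> inv a" using a xy by (simp flip: m_assoc)
    then show "?c a (x \<otimes> y) = ?c a x \<otimes> ?c a y" using a xy by (simp add: m_assoc)
  qed (use a in auto)
  moreover have "bij_betw (?c a) (carrier G) (carrier G)"
    by (rule bij_betw_byWitness[where f' = "?c (inv a)"]) (use a inv in auto)
  ultimately show ?thesis by (simp add: carrier_TopAut)
qed

end

section \<open>The action on cosets\<close>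

locale invariant_basis = topgroup +
  fixes \<S>
  assumes polish_group: "polish_group G T"
    and basis: "open_subgroup_basis G T \<S>"
    and invariant: "\<And>\<Phi> U. \<Phi> \<in> carrier (TopAut G T) \<Longrightarrow> U \<in> \<S> \<Longrightarrow> \<Phi> ` U \<in> \<S>"
begin

lemma completely_metrizable: "completely_metrizable_space T"
  using polish_group by (simp add: polish_group_def)

lemma separable: "separable_space T"
  using polish_group by (simp add: polish_group_def)

lemma Hausdorff: "Hausdorff_space T"
  using completely_metrizable completely_metrizable_imp_metrizable_space metrizable_imp_Hausdorff_space by blast

lemma basis_subgroup: "U \<in> \<S> \<Longrightarrow> subgroup U G"
  using basis by (simp add: open_subgroup_basis_def)

lemma basis_subset: "U \<in> \<S> \<Longrightarrow> U \<subseteq> carrier G"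
  using basis_subgroup subgroup.subset by blast

lemma basis_open: "U \<in> \<S> \<Longrightarrow> openin T U"
  using basis by (simp add: open_subgroup_basis_def)

text \<open>Translation by \<open>inv g\<close> moves the question to the identity, where the basis
  is given.\<close>

lemma basis_coset:
  assumes W: "openin T W" "g \<in> W"
  obtains U where "U \<in> \<S>" "g <# U \<subseteq> W"
proof -
  have g: "g \<in> carrier G" and WG: "W \<subseteq> carrier G" using W openin_subset topspace_eq by blast+
  have "\<one> \<in> inv g <# W" using g W WG by (subst l_coset_mem_iff) auto
  moreover have "openin T (inv g <# W)" using g W by (intro openin_l_coset) auto
  ultimately obtain U V where "U \<in> \<S>" "U \<subseteq> inv g <# W"
    using basis unfolding open_subgroup_basis_def neighbourhood_basis_def neighbourhood_base_at_def by metis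
  moreover have "g <# (inv g <# W) = W" using g WG by (simp add: lcos_m_assoc lcos_mult_one)
  ultimately show thesis using that by (force simp: l_coset_def)
qed

lemma basis_nonempty: "\<S> \<noteq> {}"
proof -
  have "openin T (carrier G)" using openin_topspace topspace_eq by metis
  then show ?thesis using basis_coset[OF _ one_closed] by blast
qed

lemma basis_separates:
  assumes "x \<in> carrier G" "y \<in> carrier G" "x \<noteq> y"
  obtains U where "U \<in> \<S>" "inv x \<otimes> y \<notin> U"
proof -
  obtain W where W: "openin T W" "x \<in> W" "y \<notin> W"
    using Hausdorff assms unfolding Hausdorff_space_def topspace_eq disjnt_iff by metis
  obtain U where U: "U \<in> \<S>" "x <# U \<subseteq> W" using basis_coset[OF W(1,2)] .
  have "inv x \<otimes> y \<notin> U" using U W(3) assms basis_subset[OF U(1)] l_coset_mem_iff by blast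
  then show thesis using that U by blast
qed

definition \<Omega> :: "'a set set" where
  "\<Omega> = {g <# U | g U. g \<in> carrier G \<and> U \<in> \<S>}"

lemma \<Omega>I: "g \<in> carrier G \<Longrightarrow> U \<in> \<S> \<Longrightarrow> g <# U \<in> \<Omega>"
  by (auto simp: \<Omega>_def)

lemma \<Omega>E:
  assumes "A \<in> \<Omega>" obtains g U where "g \<in> carrier G" "U \<in> \<S>" "A = g <# U"
  using assms by (auto simp: \<Omega>_def)

lemma basis_in_\<Omega>: "U \<in> \<S> \<Longrightarrow> U \<in> \<Omega>"
  using \<Omega>I[OF one_closed, of U] basis_subset by (simp add: lcos_mult_one)

lemma \<Omega>_subset: "A \<in> \<Omega> \<Longrightarrow> A \<subseteq> carrier G"
  by (metis \<Omega>E basis_subset l_coset_subset_G)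

lemma l_coset_\<Omega>: "g \<in> carrier G \<Longrightarrow> A \<in> \<Omega> \<Longrightarrow> g <# A \<in> \<Omega>"
  by (metis \<Omega>E \<Omega>I basis_subset lcos_m_assoc m_closed)

lemma TopAut_image_\<Omega>: "\<Phi> \<in> carrier Aut \<Longrightarrow> A \<in> \<Omega> \<Longrightarrow> \<Phi> ` A \<in> \<Omega>"
  by (metis \<Omega>E \<Omega>I basis_subset TopAut_image_l_coset TopAut_closed invariant)

text \<open>A coset of a basic subgroup is open, so it contains a point of a countable dense set and
  is determined by that point and the subgroup.\<close>

lemma countable_\<Omega>: "countable \<Omega>"
proof -
  obtain C where C: "countable C" "C \<subseteq> carrier G" "T closure_of C = carrier G"
    using separable unfolding separable_space_def topspace_eq by blast
  have "\<Omega> \<subseteq> (\<lambda>(c, U). c <# U) ` (C \<times> \<S>)"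
  proof
    fix A assume "A \<in> \<Omega>"
    then obtain g U where g: "g \<in> carrier G" "U \<in> \<S>" "A = g <# U" by (rule \<Omega>E)
    interpret U: subgroup U G using g by (intro basis_subgroup)
    have "g \<in> g <# U" using g by (subst l_coset_mem_iff) auto
    moreover have "openin T (g <# U)" using g by (intro openin_l_coset basis_open)
    moreover have "g \<in> T closure_of C" using g C by simp
    ultimately obtain c where c: "c \<in> C" "c \<in> g <# U" unfolding in_closure_of by metis
    then have "c <# U = g <# U"
      using C g U.subset by (subst l_coset_eq_iff) (auto simp: l_coset_mem_iff basis_subgroup subsetD)
    then show "A \<in> (\<lambda>(c, U). c <# U) ` (C \<times> \<S>)"
      using c g by (intro image_eqI[of _ _ "(c, U)"]) auto
  qed
  moreover have "countable (C \<times> \<S>)"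
    using C basis by (auto simp: open_subgroup_basis_def)
  ultimately show ?thesis by (meson countable_image countable_subset)
qed

text \<open>The factor \<open>nat\<close> makes the set acted on infinite even if \<open>G\<close> is finite, so that it can be identified with \<open>nat\<close>.\<close>

definition code :: "'a set \<times> nat \<Rightarrow> nat" where
  "code = (SOME h. bij_betw h (\<Omega> \<times> UNIV) UNIV)"

lemma bij_betw_code: "bij_betw code (\<Omega> \<times> UNIV) UNIV"
proof -
  have "countable (\<Omega> \<times> (UNIV :: nat set))" using countable_\<Omega> by auto
  moreover obtain U where "U \<in> \<Omega>" using basis_nonempty basis_in_\<Omega> by blast
  then have "infinite (\<Omega> \<times> (UNIV :: nat set))"
    by (auto simp: finite_cartesian_product_iff)
  ultimately have "\<exists>h :: 'a set \<times> nat \<Rightarrow> nat. bij_betw h (\<Omega> \<times> UNIV) UNIV"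
    by (metis countableE_infinite)
  then show ?thesis unfolding code_def by (rule someI_ex)
qed

lemma code_eq_iff: "A \<in> \<Omega> \<Longrightarrow> B \<in> \<Omega> \<Longrightarrow> code (A, i) = code (B, j) \<longleftrightarrow> A = B \<and> i = j"
  using bij_betw_imp_inj_on[OF bij_betw_code] by (auto dest: inj_onD)

lemma code_cases: obtains A i where "A \<in> \<Omega>" "n = code (A, i)"
proof -
  have "n \<in> code ` (\<Omega> \<times> UNIV)" using bij_betw_imp_surj_on[OF bij_betw_code] by simp
  then show thesis using that by auto
qed

text \<open>All copies of \<open>\<Omega>\<close> are moved in the same way, so the values at codes
  with index 0 carry the whole information.\<close>

definition lift :: "('a set \<Rightarrow> 'a set) \<Rightarrow> nat \<Rightarrow> nat" where
  "lift p n = (let (A, i) = inv_into (\<Omega> \<times> UNIV) code n in code (p A, i))"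

lemma lift_code: "A \<in> \<Omega> \<Longrightarrow> lift p (code (A, i)) = code (p A, i)"
  unfolding lift_def using bij_betw_imp_inj_on[OF bij_betw_code] by simp

lemma lift_comp:
  assumes "\<And>A. A \<in> \<Omega> \<Longrightarrow> q A \<in> \<Omega>" "\<And>A. A \<in> \<Omega> \<Longrightarrow> p (q A) = r A"
  shows "lift p \<circ> lift q = lift r"
proof
  fix n
  obtain A i where "A \<in> \<Omega>" "n = code (A, i)" by (rule code_cases)
  then show "(lift p \<circ> lift q) n = lift r n" using assms by (simp add: lift_code)
qed

lemma lift_id: "(\<And>A. A \<in> \<Omega> \<Longrightarrow> p A = A) \<Longrightarrow> lift p = id"
  by (rule ext) (metis code_cases lift_code id_apply)

lemma lift_bij:
  assumes "\<And>A. A \<in> \<Omega> \<Longrightarrow> p A \<in> \<Omega>" "\<And>A. A \<in> \<Omega> \<Longrightarrow> q A \<in> \<Omega>"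
    and "\<And>A. A \<in> \<Omega> \<Longrightarrow> p (q A) = A" "\<And>A. A \<in> \<Omega> \<Longrightarrow> q (p A) = A"
  shows "bij (lift p)"
proof (rule o_bij)
  show "lift p \<circ> lift q = id" "lift q \<circ> lift p = id"
    using lift_comp[of q p "\<lambda>A. A"] lift_comp[of p q "\<lambda>A. A"] lift_id[of "\<lambda>A. A"] assms by simp_all
qed

definition \<theta> :: "'a \<Rightarrow> nat \<Rightarrow> nat" where "\<theta> g = lift (\<lambda>A. g <# A)"

definition \<Gamma> :: "('a \<Rightarrow> 'a) \<Rightarrow> nat \<Rightarrow> nat" where "\<Gamma> \<Phi> = lift (\<lambda>A. \<Phi> ` A)"

abbreviation Ghat where "Ghat \<equiv> \<theta> ` carrier G"

lemma \<theta>_code: "A \<in> \<Omega> \<Longrightarrow> \<theta> g (code (A, i)) = code (g <# A, i)"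
  by (simp add: \<theta>_def lift_code)

lemma \<Gamma>_code: "A \<in> \<Omega> \<Longrightarrow> \<Gamma> \<Phi> (code (A, i)) = code (\<Phi> ` A, i)"
  by (simp add: \<Gamma>_def lift_code)

lemma \<theta>_bij: "g \<in> carrier G \<Longrightarrow> bij (\<theta> g)"
  unfolding \<theta>_def
  by (rule lift_bij[where q = "\<lambda>A. inv g <# A"])
     (auto simp: l_coset_\<Omega> lcos_m_assoc \<Omega>_subset lcos_mult_one)

lemma \<theta>_hom: "\<theta> \<in> hom G Sinf"
proof (rule homI)
  fix x y assume xy: "x \<in> carrier G" "y \<in> carrier G"
  have "\<theta> x \<circ> \<theta> y = \<theta> (x \<otimes> y)"
    unfolding \<theta>_def by (rule lift_comp) (use xy in \<open>auto simp: l_coset_\<Omega> lcos_m_assoc \<Omega>_subset\<close>)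
  then show "\<theta> (x \<otimes> y) = \<theta> x \<otimes>\<^bsub>Sinf\<^esub> \<theta> y" using xy by (simp add: mult_Sinf \<theta>_bij)
qed (simp add: carrier_Sinf \<theta>_bij)

sublocale \<theta>: group_hom G Sinf \<theta>
  by (unfold_locales) (auto simp: \<theta>_hom group_Sinf group.is_group group.is_monoid group.axioms)

text \<open>If \<open>x\<close> and \<open>y\<close> act alike, then \<open>x <# U = y <# U\<close>
  for every basic \<open>U\<close>, so \<open>inv x \<otimes> y\<close> lies in all of them, against
  \<open>basis_separates\<close>.\<close>

lemma \<theta>_inj: "inj_on \<theta> (carrier G)"
proof (rule inj_onI, rule ccontr)
  fix x y assume xy: "x \<in> carrier G" "y \<in> carrier G" "\<theta> x = \<theta> y" "x \<noteq> y"
  obtain U where U: "U \<in> \<S>" "inv x \<otimes> y \<notin> U" using basis_separates xy by metis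
  have "code (x <# U, 0) = code (y <# U, 0)"
    using xy U basis_in_\<Omega> by (metis \<theta>_code)
  then have "y <# U = x <# U" using xy U by (simp add: code_eq_iff \<Omega>I)
  then show False using l_coset_eq_iff[OF basis_subgroup[OF U(1)]] xy U by blast
qed

lemma continuous_map_\<theta>: "continuous_map T Sinf_top \<theta>"
proof (rule continuous_map_into_Sinf)
  show "\<theta> x \<in> carrier Sinf" if "x \<in> topspace T" for x using that by (simp add: topspace_eq)
  fix n m
  obtain A i where A: "A \<in> \<Omega>" "n = code (A, i)" by (rule code_cases)
  obtain g U where g: "g \<in> carrier G" "U \<in> \<S>" "A = g <# U" using A by (elim \<Omega>E)
  show "openin T {x \<in> topspace T. \<theta> x n = m}"
  proof (cases "\<exists>y\<in>carrier G. \<theta> y n = m")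
    case False
    then have "{x \<in> topspace T. \<theta> x n = m} = {}" by (auto simp: topspace_eq)
    then show ?thesis by (metis openin_empty)
  next
    case True
    then obtain y where y: "y \<in> carrier G" "\<theta> y n = m" by blast
    \<comment> \<open>Once the value \<open>m\<close> is attained at some \<open>y\<close>, the
      condition on \<open>x\<close> becomes membership of a continuous expression in the open
      subgroup \<open>U\<close>.\<close>
    have "\<theta> x n = m \<longleftrightarrow> inv (y \<otimes> g) \<otimes> (x \<otimes> g) \<in> U" if x: "x \<in> carrier G" for x
    proof -
      have "\<theta> x n = m \<longleftrightarrow> x <# A = y <# A"
        using A x y l_coset_\<Omega> by (auto simp: \<theta>_code code_eq_iff)
      also have "\<dots> \<longleftrightarrow> (x \<otimes> g) <# U = (y \<otimes> g) <# U"
        using g x y by (simp add: lcos_m_assoc basis_subset)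
      finally show ?thesis using g x y by (simp add: l_coset_eq_iff basis_subgroup)
    qed
    then have "{x \<in> topspace T. \<theta> x n = m} = {x \<in> topspace T. inv (y \<otimes> g) \<otimes> (x \<otimes> g) \<in> U}"
      by (auto simp: topspace_eq)
    also have "openin T \<dots>"
      using y g by (intro openin_continuous_map_preimage[OF _ basis_open] continuous_map_mult
        continuous_map_constant continuous_map_id[unfolded id_def]) auto
    finally show ?thesis .
  qed
qed

lemma homeomorphic_map_\<theta>: "homeomorphic_map T (subtopology Sinf_top Ghat) \<theta>"
proof (rule bijective_open_imp_homeomorphic_map)
  have Ghat: "Ghat \<subseteq> carrier Sinf" by auto
  show "continuous_map T (subtopology Sinf_top Ghat) \<theta>"
    using continuous_map_\<theta> by (auto simp: continuous_map_in_subtopology topspace_eq)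
  show "\<theta> ` topspace T = topspace (subtopology Sinf_top Ghat)"
    using Ghat by (auto simp: topspace_Sinf_top topspace_eq)
  show "inj_on \<theta> (topspace T)" using \<theta>_inj by (simp add: topspace_eq)
  show "open_map T (subtopology Sinf_top Ghat) \<theta>"
    unfolding open_map_def
  proof (intro allI impI)
    fix W assume W: "openin T W"
    show "openin (subtopology Sinf_top Ghat) (\<theta> ` W)"
    proof (subst openin_subopen, intro ballI)
      fix f assume "f \<in> \<theta> ` W"
      then obtain g where g: "g \<in> W" "f = \<theta> g" by blast
      have gG: "g \<in> carrier G" using g W openin_subset topspace_eq by blast
      obtain U where U: "U \<in> \<S>" "g <# U \<subseteq> W" using basis_coset[OF W g(1)] .
      \<comment> \<open>One value traps the point: if \<open>\<theta> h\<close> agrees with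
        \<open>\<theta> g\<close> at the code of \<open>U\<close>, then \<open>h\<close> lies in
        \<open>g <# U\<close>, hence in \<open>W\<close>.\<close>
      let ?O = "{f \<in> carrier Sinf. f (code (U, 0)) = code (g <# U, 0)} \<inter> Ghat"
      have "openin (subtopology Sinf_top Ghat) ?O"
        unfolding openin_subtopology using openin_Sinf_top_eval by blast
      moreover have "f \<in> ?O" using g gG U by (auto simp: \<theta>_code basis_in_\<Omega>)
      moreover have "?O \<subseteq> \<theta> ` W"
      proof
        fix f' assume f': "f' \<in> ?O"
        then obtain h where h: "h \<in> carrier G" "f' = \<theta> h" by blast
        have "h <# U = g <# U" using f' h gG U by (simp add: \<theta>_code basis_in_\<Omega> code_eq_iff \<Omega>I)
        then have "h \<in> g <# U"
          using h gG U l_coset_eq_iff[OF basis_subgroup[OF U(1)]] l_coset_mem_iff basis_subset by metis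
        then show "f' \<in> \<theta> ` W" using h U by blast
      qed
      ultimately show "\<exists>V. openin (subtopology Sinf_top Ghat) V \<and> f \<in> V \<and> V \<subseteq> \<theta> ` W" by blast
    qed
  qed
qed

lemma subgroup_Ghat: "subgroup Ghat Sinf"
  by (rule \<theta>.img_is_subgroup)

lemma closedin_Ghat: "closedin Sinf_top Ghat"
proof (rule Sinf.completely_metrizable_subgroup_closed[OF completely_metrizable_Sinf_top subgroup_Ghat])
  show "completely_metrizable_space (subtopology Sinf_top Ghat)"
    using completely_metrizable homeomorphic_completely_metrizable_space
      homeomorphic_map_imp_homeomorphic_space[OF homeomorphic_map_\<theta>] by blast
qed

lemma iso_\<theta>: "\<theta> \<in> iso G (Sinf\<lparr>carrier := Ghat\<rparr>)"
  unfolding iso_def using \<theta>_inj by (auto simp: bij_betw_def hom_def)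

lemma cosets_of_eq: "cosets_of G \<S> = \<Omega>"
proof
  show "\<Omega> \<subseteq> cosets_of G \<S>" by (auto simp: \<Omega>_def cosets_of_def)
  show "cosets_of G \<S> \<subseteq> \<Omega>"
  proof
    fix A assume "A \<in> cosets_of G \<S>"
    then obtain U g where Ug: "U \<in> \<S>" "g \<in> carrier G" "A = g <# U \<or> A = U #> g"
      by (auto simp: cosets_of_def)
    show "A \<in> \<Omega>"
    proof (cases "A = g <# U")
      case False
      \<comment> \<open>Conjugation by \<open>inv g\<close>: with this choice, \<open>g\<close>
        times the conjugate of \<open>U\<close> is the right coset \<open>U #> g\<close>.\<close>
      define c where "c = (\<lambda>x\<in>carrier G. inv g \<otimes> x \<otimes> inv (inv g))"
      have "c \<in> carrier Aut" unfolding c_def using Ug by (intro inner_TopAut) auto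
      then have "c ` U \<in> \<S>" using Ug invariant by blast
      moreover have "g <# (c ` U) = U #> g"
      proof -
        have "g \<otimes> c u = u \<otimes> g" if "u \<in> U" for u
          using that Ug basis_subset[OF Ug(1)] by (simp add: c_def subsetD flip: m_assoc)
        then show ?thesis by (auto simp: l_coset_def r_coset_def)
      qed
      ultimately show ?thesis using \<Omega>I[of g "c ` U"] Ug False by simp
    qed (use Ug \<Omega>I in simp)
  qed
qed

end

text \<open>The operations of \<open>H\<close> are those of \<open>G\<close> read through the
  inverse \<open>k\<close> of the embedding. In this way \<open>\<tau>\<close>, defined as a
  quotient topology, is recognised as a group topology.\<close>

lemma (in topgroup) topological_group_embedding:
  assumes H: "group H" and h: "h \<in> hom H G" and X: "topspace X = carrier H"
    and emb: "homeomorphic_map X (subtopology T (h ` carrier H)) h"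
  shows "topological_group H X"
proof -
  interpret H: group H by (rule H)
  interpret h: group_hom H G h by unfold_locales (rule h)
  obtain k where k: "homeomorphic_maps X (subtopology T (h ` carrier H)) h k"
    using emb by (auto simp: homeomorphic_map_maps)
  have kh: "k (h x) = x" if "x \<in> carrier H" for x using k that by (simp add: homeomorphic_maps_def X)
  have k_cont: "continuous_map (subtopology T (h ` carrier H)) X k" using k by (simp add: homeomorphic_maps_def)
  have h_cont: "continuous_map X T h"
    using k by (auto simp: homeomorphic_maps_def intro: continuous_map_into_fulltopology)
  have "continuous_map (prod_topology X X) (subtopology T (h ` carrier H)) (\<lambda>z. h (fst z) \<otimes> h (snd z))"
  proof (unfold continuous_map_in_subtopology, intro conjI)
    show "continuous_map (prod_topology X X) T (\<lambda>z. h (fst z) \<otimes> h (snd z))"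
      by (intro continuous_map_mult continuous_map_compose[OF continuous_map_fst h_cont, unfolded o_def]
        continuous_map_compose[OF continuous_map_snd h_cont, unfolded o_def])
  qed (auto simp: X simp flip: h.hom_mult)
  from continuous_map_compose[OF this k_cont]
  have "continuous_map (prod_topology X X) X (\<lambda>(x, y). x \<otimes>\<^bsub>H\<^esub> y)"
    by (rule continuous_map_eq) (auto simp: X kh simp flip: h.hom_mult)
  moreover have "continuous_map X (subtopology T (h ` carrier H)) (\<lambda>x. inv (h x))"
    unfolding continuous_map_in_subtopology
    by (auto simp: X simp flip: h.hom_inv intro!: continuous_map_inv h_cont)
  from continuous_map_compose[OF this k_cont]
  have "continuous_map X X (\<lambda>x. inv\<^bsub>H\<^esub> x)"
    by (rule continuous_map_eq) (auto simp: X kh simp flip: h.hom_inv)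
  ultimately show ?thesis using H X by (simp add: topological_group_def)
qed

section \<open>Automorphisms induced by the normaliser\<close>

context invariant_basis
begin

abbreviation Norm where "Norm \<equiv> normalizer Sinf Ghat"

abbreviation NormG where "NormG \<equiv> Sinf\<lparr>carrier := Norm\<rparr>"

abbreviation \<Psi> where "\<Psi> \<equiv> conj_aut G \<theta>"

lemma subgroup_Norm: "subgroup Norm Sinf"
  by (rule group.normalizer_imp_subgroup[OF group_Sinf]) auto

lemma Norm_iff: "\<alpha> \<in> Norm \<longleftrightarrow> \<alpha> \<in> carrier Sinf \<and>
    (\<forall>g\<in>carrier G. \<alpha> \<otimes>\<^bsub>Sinf\<^esub> \<theta> g \<otimes>\<^bsub>Sinf\<^esub> inv\<^bsub>Sinf\<^esub> \<alpha> \<in> Ghat) \<and>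
    (\<forall>g\<in>carrier G. inv\<^bsub>Sinf\<^esub> \<alpha> \<otimes>\<^bsub>Sinf\<^esub> \<theta> g \<otimes>\<^bsub>Sinf\<^esub> \<alpha> \<in> Ghat)"
  by (subst group.mem_normalizer_iff[OF group_Sinf]) auto

lemma Norm_carrier: "\<alpha> \<in> Norm \<Longrightarrow> \<alpha> \<in> carrier Sinf"
  by (simp add: Norm_iff)

lemma Norm_bij: "\<alpha> \<in> Norm \<Longrightarrow> bij \<alpha>"
  by (simp add: Norm_iff carrier_Sinf)

lemma closedin_Norm: "closedin Sinf_top Norm"
  by (rule Sinf.closedin_normalizer[OF _ closedin_Ghat]) auto

lemma \<Psi>_closed: "\<alpha> \<in> Norm \<Longrightarrow> g \<in> carrier G \<Longrightarrow> \<Psi> \<alpha> g \<in> carrier G"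
  by (auto simp: conj_aut_def Norm_iff intro!: inv_into_into)

lemma \<theta>_\<Psi>: "\<alpha> \<in> Norm \<Longrightarrow> g \<in> carrier G \<Longrightarrow>
    \<theta> (\<Psi> \<alpha> g) = \<alpha> \<otimes>\<^bsub>Sinf\<^esub> \<theta> g \<otimes>\<^bsub>Sinf\<^esub> inv\<^bsub>Sinf\<^esub> \<alpha>"
  by (auto simp: conj_aut_def Norm_iff intro!: f_inv_into_f)

text \<open>Injectivity of \<open>\<theta>\<close> lets \<open>\<Psi>\<close> be evaluated by
  exhibiting the element, which keeps \<open>inv_into\<close> out of later computations.\<close>

lemma \<Psi>_eqI:
  assumes "\<alpha> \<in> Norm" "g \<in> carrier G" "h \<in> carrier G" "\<theta> h = \<alpha> \<otimes>\<^bsub>Sinf\<^esub> \<theta> g \<otimes>\<^bsub>Sinf\<^esub> inv\<^bsub>Sinf\<^esub> \<alpha>"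
  shows "\<Psi> \<alpha> g = h"
  using assms \<theta>_\<Psi> \<Psi>_closed inj_onD[OF \<theta>_inj] by metis

text \<open>Multiplying the conjugation formula by \<open>\<alpha>\<close> on the right removes the
  inverse and leaves an intertwining relation that can be read pointwise.\<close>

lemma \<theta>_\<Psi>_apply:
  assumes "\<alpha> \<in> Norm" "g \<in> carrier G"
  shows "\<theta> (\<Psi> \<alpha> g) (\<alpha> n) = \<alpha> (\<theta> g n)"
proof -
  have "\<theta> (\<Psi> \<alpha> g) \<otimes>\<^bsub>Sinf\<^esub> \<alpha> = \<alpha> \<otimes>\<^bsub>Sinf\<^esub> \<theta> g"
    using assms by (simp add: \<theta>_\<Psi> \<theta>.H.m_assoc Norm_carrier)
  then show ?thesis
    using assms by (auto simp: mult_Sinf Norm_bij \<theta>_bij \<Psi>_closed dest: fun_cong[of _ _ n])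
qed

lemma \<Psi>_mult:
  assumes "\<alpha> \<in> Norm" "\<beta> \<in> Norm"
  shows "\<Psi> (\<alpha> \<otimes>\<^bsub>Sinf\<^esub> \<beta>) = compose (carrier G) (\<Psi> \<alpha>) (\<Psi> \<beta>)"
proof
  fix g
  show "\<Psi> (\<alpha> \<otimes>\<^bsub>Sinf\<^esub> \<beta>) g = compose (carrier G) (\<Psi> \<alpha>) (\<Psi> \<beta>) g"
  proof (cases "g \<in> carrier G")
    case True
    have "\<theta> (\<Psi> \<alpha> (\<Psi> \<beta> g)) = (\<alpha> \<otimes>\<^bsub>Sinf\<^esub> \<beta>) \<otimes>\<^bsub>Sinf\<^esub> \<theta> g \<otimes>\<^bsub>Sinf\<^esub> inv\<^bsub>Sinf\<^esub> (\<alpha> \<otimes>\<^bsub>Sinf\<^esub> \<beta>)"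
      using assms True by (simp add: \<theta>_\<Psi> \<Psi>_closed Norm_carrier \<theta>.H.m_assoc \<theta>.H.inv_mult_group)
    moreover have "\<alpha> \<otimes>\<^bsub>Sinf\<^esub> \<beta> \<in> Norm" using assms subgroup.m_closed[OF subgroup_Norm] by blast
    ultimately show ?thesis
      using assms True by (simp add: compose_def \<Psi>_closed \<Psi>_eqI)
  qed (simp add: conj_aut_def compose_def)
qed

lemma \<Psi>_one: "\<Psi> \<one>\<^bsub>Sinf\<^esub> = (\<lambda>x\<in>carrier G. x)"
proof
  fix g show "\<Psi> \<one>\<^bsub>Sinf\<^esub> g = (\<lambda>x\<in>carrier G. x) g"
  proof (cases "g \<in> carrier G")
    case True
    then have "\<Psi> \<one>\<^bsub>Sinf\<^esub> g = g"
      using subgroup.one_closed[OF subgroup_Norm] by (intro \<Psi>_eqI) auto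
    then show ?thesis using True by simp
  qed (simp add: conj_aut_def)
qed

text \<open>On \<open>Ghat\<close> the choice made by \<open>inv_into\<close> agrees with the
  continuous inverse \<open>k\<close> of the embedding, so \<open>\<Psi> \<alpha>\<close> is a
  composite of \<open>\<theta>\<close>, conjugation in \<open>Sinf\<close> and
  \<open>k\<close>.\<close>

lemma continuous_map_\<Psi>_arg:
  assumes \<alpha>: "\<alpha> \<in> Norm"
  shows "continuous_map T T (\<Psi> \<alpha>)"
proof -
  obtain k where k: "homeomorphic_maps T (subtopology Sinf_top Ghat) \<theta> k"
    using homeomorphic_map_\<theta> by (auto simp: homeomorphic_map_maps)
  then have k_cont: "continuous_map (subtopology Sinf_top Ghat) T k" by (simp add: homeomorphic_maps_def)
  have "continuous_map T Sinf_top (\<lambda>g. \<alpha> \<otimes>\<^bsub>Sinf\<^esub> \<theta> g \<otimes>\<^bsub>Sinf\<^esub> inv\<^bsub>Sinf\<^esub> \<alpha>)"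
    by (intro Sinf.continuous_map_mult Sinf.continuous_map_constant continuous_map_\<theta>)
       (use \<alpha> in \<open>auto simp: Norm_carrier\<close>)
  then have "continuous_map T (subtopology Sinf_top Ghat) (\<lambda>g. \<alpha> \<otimes>\<^bsub>Sinf\<^esub> \<theta> g \<otimes>\<^bsub>Sinf\<^esub> inv\<^bsub>Sinf\<^esub> \<alpha>)"
    using \<alpha> by (auto simp: continuous_map_in_subtopology topspace_eq Norm_iff)
  from continuous_map_compose[OF this k_cont] show ?thesis
  proof (rule continuous_map_eq)
    fix g assume g: "g \<in> topspace T"
    then have "\<Psi> \<alpha> g \<in> topspace T" using \<alpha> by (simp add: \<Psi>_closed topspace_eq)
    then have "k (\<theta> (\<Psi> \<alpha> g)) = \<Psi> \<alpha> g" using k by (simp add: homeomorphic_maps_def)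
    then show "(k \<circ> (\<lambda>g. \<alpha> \<otimes>\<^bsub>Sinf\<^esub> \<theta> g \<otimes>\<^bsub>Sinf\<^esub> inv\<^bsub>Sinf\<^esub> \<alpha>)) g = \<Psi> \<alpha> g"
      using g \<alpha> by (simp add: \<theta>_\<Psi> topspace_eq)
  qed
qed

text \<open>The inverse of \<open>\<Psi> \<alpha>\<close> is \<open>\<Psi>\<close> of the inverse
  permutation, and both are continuous.\<close>

lemma \<Psi>_TopAut:
  assumes \<alpha>: "\<alpha> \<in> Norm"
  shows "\<Psi> \<alpha> \<in> carrier Aut"
proof -
  let ?\<beta> = "inv\<^bsub>Sinf\<^esub> \<alpha>"
  have \<beta>: "?\<beta> \<in> Norm" using \<alpha> subgroup.m_inv_closed[OF subgroup_Norm] by blast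
  have inv: "\<Psi> ?\<beta> (\<Psi> \<alpha> g) = g" "\<Psi> \<alpha> (\<Psi> ?\<beta> g) = g" if "g \<in> carrier G" for g
    using \<Psi>_mult[OF \<beta> \<alpha>] \<Psi>_mult[OF \<alpha> \<beta>] \<Psi>_one Norm_carrier[OF \<alpha>] that
    by (auto simp: compose_def dest!: fun_cong[of _ _ g])
  have "homeomorphic_maps T T (\<Psi> \<alpha>) (\<Psi> ?\<beta>)"
    unfolding homeomorphic_maps_def topspace_eq
    using continuous_map_\<Psi>_arg[OF \<alpha>] continuous_map_\<Psi>_arg[OF \<beta>] inv by blast
  then have "homeomorphic_map T T (\<Psi> \<alpha>)" by (rule homeomorphic_maps_imp_map)
  moreover have "bij_betw (\<Psi> \<alpha>) (carrier G) (carrier G)"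
    by (rule bij_betw_byWitness[where f' = "\<Psi> ?\<beta>"]) (use inv \<alpha> \<beta> \<Psi>_closed in auto)
  moreover have "\<Psi> \<alpha> \<in> hom G G"
  proof (rule homI)
    fix x y assume xy: "x \<in> carrier G" "y \<in> carrier G"
    have cancel: "?\<beta> \<otimes>\<^bsub>Sinf\<^esub> (\<alpha> \<otimes>\<^bsub>Sinf\<^esub> k) = k" if "k \<in> carrier Sinf" for k
      using that Norm_carrier[OF \<alpha>] by (simp flip: \<theta>.H.m_assoc)
    have "\<theta> (\<Psi> \<alpha> x \<otimes> \<Psi> \<alpha> y) = \<alpha> \<otimes>\<^bsub>Sinf\<^esub> \<theta> (x \<otimes> y) \<otimes>\<^bsub>Sinf\<^esub> ?\<beta>"
      using xy \<alpha> Norm_carrier[OF \<alpha>]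
      by (simp add: \<Psi>_closed \<theta>_\<Psi> \<theta>.H.m_assoc cancel)
    then show "\<Psi> \<alpha> (x \<otimes> y) = \<Psi> \<alpha> x \<otimes> \<Psi> \<alpha> y"
      using xy \<alpha> by (intro \<Psi>_eqI) (auto simp: \<Psi>_closed)
  qed (use \<alpha> \<Psi>_closed in auto)
  moreover have "\<Psi> \<alpha> \<in> extensional (carrier G)" by (simp add: conj_aut_def)
  ultimately show ?thesis by (simp add: carrier_TopAut)
qed

lemma \<Psi>_hom: "\<Psi> \<in> hom NormG Aut"
  by (rule homI) (auto simp: \<Psi>_TopAut \<Psi>_mult mult_TopAut)

lemma group_NormG: "group NormG"
  by (rule group.subgroup_imp_group[OF group_Sinf subgroup_Norm])

sublocale \<Psi>: group_hom NormG Aut \<Psi>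
  by (intro group_hom.intro group_hom_axioms.intro group_NormG group_TopAut \<Psi>_hom)

section \<open>The section from automorphisms to permutations\<close>

lemma TopAut_inv_image:
  assumes "\<Phi> \<in> carrier Aut" "A \<subseteq> carrier G"
  shows "(inv\<^bsub>Aut\<^esub> \<Phi>) ` \<Phi> ` A = A" "\<Phi> ` (inv\<^bsub>Aut\<^esub> \<Phi>) ` A = A"
proof -
  have "(\<lambda>x. (inv\<^bsub>Aut\<^esub> \<Phi>) (\<Phi> x)) ` A = (\<lambda>x. x) ` A" "(\<lambda>x. \<Phi> ((inv\<^bsub>Aut\<^esub> \<Phi>) x)) ` A = (\<lambda>x. x) ` A"
    using assms by (auto intro!: image_cong simp: inv_TopAut_apply subset_iff)
  then show "(inv\<^bsub>Aut\<^esub> \<Phi>) ` \<Phi> ` A = A" "\<Phi> ` (inv\<^bsub>Aut\<^esub> \<Phi>) ` A = A"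
    by (simp_all add: image_image)
qed

lemma inv_TopAut_closed: "\<Phi> \<in> carrier Aut \<Longrightarrow> inv\<^bsub>Aut\<^esub> \<Phi> \<in> carrier Aut"
  by (rule \<Psi>.H.inv_closed)

lemma \<Gamma>_bij: "\<Phi> \<in> carrier Aut \<Longrightarrow> bij (\<Gamma> \<Phi>)"
  unfolding \<Gamma>_def
  by (rule lift_bij[where q = "\<lambda>A. (inv\<^bsub>Aut\<^esub> \<Phi>) ` A"])
     (simp_all add: TopAut_image_\<Omega> TopAut_inv_image \<Omega>_subset inv_TopAut_closed)

lemma \<Gamma>_hom: "\<Gamma> \<in> hom Aut Sinf"
proof (rule homI)
  fix \<Phi> \<Phi>' assume *: "\<Phi> \<in> carrier Aut" "\<Phi>' \<in> carrier Aut"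
  then have "\<Gamma> \<Phi> \<circ> \<Gamma> \<Phi>' = \<Gamma> (\<Phi> \<otimes>\<^bsub>Aut\<^esub> \<Phi>')"
    unfolding \<Gamma>_def by (intro lift_comp) (auto simp: TopAut_image_\<Omega> TopAut_mult_image \<Omega>_subset)
  then show "\<Gamma> (\<Phi> \<otimes>\<^bsub>Aut\<^esub> \<Phi>') = \<Gamma> \<Phi> \<otimes>\<^bsub>Sinf\<^esub> \<Gamma> \<Phi>'" using * by (simp add: mult_Sinf \<Gamma>_bij)
qed (simp add: carrier_Sinf \<Gamma>_bij)

text \<open>Both sides send the code of \<open>A\<close> to that of
  \<open>\<Phi>(g A) = \<Phi>(g) \<Phi>(A)\<close>. The normalising property of
  \<open>\<Gamma> \<Phi>\<close> and the identity \<open>\<Psi>_\<Gamma>\<close> come from this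
  relation.\<close>

lemma \<Gamma>_\<theta>:
  assumes "\<Phi> \<in> carrier Aut" "g \<in> carrier G"
  shows "\<Gamma> \<Phi> \<otimes>\<^bsub>Sinf\<^esub> \<theta> g = \<theta> (\<Phi> g) \<otimes>\<^bsub>Sinf\<^esub> \<Gamma> \<Phi>"
proof -
  have "\<Gamma> \<Phi> \<circ> \<theta> g = lift (\<lambda>A. \<Phi> ` (g <# A))"
    unfolding \<Gamma>_def \<theta>_def by (rule lift_comp) (use assms l_coset_\<Omega> in auto)
  also have "\<dots> = \<theta> (\<Phi> g) \<circ> \<Gamma> \<Phi>"
    unfolding \<Gamma>_def \<theta>_def
    by (rule lift_comp[symmetric]) (use assms in \<open>auto simp: TopAut_image_\<Omega> TopAut_image_l_coset \<Omega>_subset\<close>)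
  finally show ?thesis using assms by (simp add: mult_Sinf \<Gamma>_bij \<theta>_bij TopAut_closed)
qed

lemma \<Gamma>_conj:
  assumes \<Phi>: "\<Phi> \<in> carrier Aut" and g: "g \<in> carrier G"
  shows "\<Gamma> \<Phi> \<otimes>\<^bsub>Sinf\<^esub> \<theta> g \<otimes>\<^bsub>Sinf\<^esub> inv\<^bsub>Sinf\<^esub> (\<Gamma> \<Phi>) = \<theta> (\<Phi> g)"
proof -
  have "\<Gamma> \<Phi> \<in> carrier Sinf" using \<Phi> by (simp add: carrier_Sinf \<Gamma>_bij)
  then show ?thesis using assms by (simp add: \<Gamma>_\<theta> \<theta>.H.m_assoc TopAut_closed)
qed

lemma \<Gamma>_Norm:
  assumes \<Phi>: "\<Phi> \<in> carrier Aut"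
  shows "\<Gamma> \<Phi> \<in> Norm"
proof -
  have car: "\<Gamma> \<Phi> \<in> carrier Sinf" using \<Phi> by (simp add: carrier_Sinf \<Gamma>_bij)
  have "inv\<^bsub>Sinf\<^esub> (\<Gamma> \<Phi>) \<otimes>\<^bsub>Sinf\<^esub> \<theta> g \<otimes>\<^bsub>Sinf\<^esub> \<Gamma> \<Phi> \<in> Ghat" if g: "g \<in> carrier G" for g
  proof -
    \<comment> \<open>Applied to the preimage of \<open>g\<close>, the relation
      \<open>\<Gamma>_\<theta>\<close> yields conjugation by the inverse.\<close>
    let ?h = "(inv\<^bsub>Aut\<^esub> \<Phi>) g"
    have h: "?h \<in> carrier G" by (rule TopAut_closed[OF inv_TopAut_closed[OF \<Phi>] g])
    have "\<theta> g \<otimes>\<^bsub>Sinf\<^esub> \<Gamma> \<Phi> = \<Gamma> \<Phi> \<otimes>\<^bsub>Sinf\<^esub> \<theta> ?h"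
      using \<Gamma>_\<theta>[OF \<Phi> h] inv_TopAut_apply[OF \<Phi> g] by simp
    then have "inv\<^bsub>Sinf\<^esub> (\<Gamma> \<Phi>) \<otimes>\<^bsub>Sinf\<^esub> \<theta> g \<otimes>\<^bsub>Sinf\<^esub> \<Gamma> \<Phi> =
        inv\<^bsub>Sinf\<^esub> (\<Gamma> \<Phi>) \<otimes>\<^bsub>Sinf\<^esub> (\<Gamma> \<Phi> \<otimes>\<^bsub>Sinf\<^esub> \<theta> ?h)"
      using car g by (simp add: \<theta>.H.m_assoc)
    also have "\<dots> = \<theta> ?h" using car h by (simp flip: \<theta>.H.m_assoc)
    finally show ?thesis using h by simp
  qed
  then show ?thesis using \<Phi> car by (simp add: Norm_iff \<Gamma>_conj TopAut_closed)
qed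

lemma \<Psi>_\<Gamma>:
  assumes \<Phi>: "\<Phi> \<in> carrier Aut"
  shows "\<Psi> (\<Gamma> \<Phi>) = \<Phi>"
proof (rule extensionalityI)
  show "\<Psi> (\<Gamma> \<Phi>) \<in> extensional (carrier G)" "\<Phi> \<in> extensional (carrier G)"
    using \<Phi> by (simp_all add: conj_aut_def carrier_TopAut)
  show "\<Psi> (\<Gamma> \<Phi>) g = \<Phi> g" if "g \<in> carrier G" for g
    using that \<Phi> by (intro \<Psi>_eqI) (simp_all add: \<Gamma>_Norm \<Gamma>_conj TopAut_closed)
qed

lemma \<Psi>_surj: "\<Psi> ` Norm = carrier Aut"
  using \<Psi>_TopAut \<Gamma>_Norm \<Psi>_\<Gamma> by (metis (no_types, lifting) image_eqI image_subsetI subsetI subset_antisym)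

text \<open>Trivial action on \<open>G\<close> means that conjugation fixes every
  \<open>\<theta> g\<close>. In the converse direction membership in the normaliser has to be
  produced too, hence the computation with the inverse.\<close>

lemma kernel_\<Psi>: "kernel NormG Aut \<Psi> = centralizer Sinf Ghat"
proof (intro equalityI subsetI)
  fix \<alpha> assume "\<alpha> \<in> kernel NormG Aut \<Psi>"
  then have \<alpha>: "\<alpha> \<in> Norm" "\<Psi> \<alpha> = (\<lambda>x\<in>carrier G. x)" by (auto simp: kernel_def one_TopAut)
  have "\<alpha> \<otimes>\<^bsub>Sinf\<^esub> \<theta> g = \<theta> g \<otimes>\<^bsub>Sinf\<^esub> \<alpha>" if g: "g \<in> carrier G" for g
  proof -
    have "\<theta> g = \<alpha> \<otimes>\<^bsub>Sinf\<^esub> \<theta> g \<otimes>\<^bsub>Sinf\<^esub> inv\<^bsub>Sinf\<^esub> \<alpha>" using \<theta>_\<Psi>[OF \<alpha>(1) g] \<alpha>(2) g by simp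
    then have "\<theta> g \<otimes>\<^bsub>Sinf\<^esub> \<alpha> = (\<alpha> \<otimes>\<^bsub>Sinf\<^esub> \<theta> g \<otimes>\<^bsub>Sinf\<^esub> inv\<^bsub>Sinf\<^esub> \<alpha>) \<otimes>\<^bsub>Sinf\<^esub> \<alpha>" by simp
    also have "\<dots> = \<alpha> \<otimes>\<^bsub>Sinf\<^esub> \<theta> g" using \<alpha> g by (simp add: \<theta>.H.m_assoc Norm_carrier)
    finally show ?thesis by simp
  qed
  then show "\<alpha> \<in> centralizer Sinf Ghat" using \<alpha>(1) Norm_carrier by (auto simp: centralizer_def)
next
  fix \<alpha> assume "\<alpha> \<in> centralizer Sinf Ghat"
  then have \<alpha>: "\<alpha> \<in> carrier Sinf" and comm: "\<And>g. g \<in> carrier G \<Longrightarrow> \<alpha> \<otimes>\<^bsub>Sinf\<^esub> \<theta> g = \<theta> g \<otimes>\<^bsub>Sinf\<^esub> \<alpha>"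
    by (auto simp: centralizer_def)
  have conj: "\<alpha> \<otimes>\<^bsub>Sinf\<^esub> \<theta> g \<otimes>\<^bsub>Sinf\<^esub> inv\<^bsub>Sinf\<^esub> \<alpha> = \<theta> g" if "g \<in> carrier G" for g
    using that \<alpha> by (simp add: comm \<theta>.H.m_assoc)
  have conj': "inv\<^bsub>Sinf\<^esub> \<alpha> \<otimes>\<^bsub>Sinf\<^esub> \<theta> g \<otimes>\<^bsub>Sinf\<^esub> \<alpha> = \<theta> g" if "g \<in> carrier G" for g
  proof -
    have "inv\<^bsub>Sinf\<^esub> \<alpha> \<otimes>\<^bsub>Sinf\<^esub> \<theta> g \<otimes>\<^bsub>Sinf\<^esub> \<alpha> = inv\<^bsub>Sinf\<^esub> \<alpha> \<otimes>\<^bsub>Sinf\<^esub> (\<alpha> \<otimes>\<^bsub>Sinf\<^esub> \<theta> g)"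
      using that \<alpha> by (simp add: comm \<theta>.H.m_assoc)
    then show ?thesis using that \<alpha> by (simp flip: \<theta>.H.m_assoc)
  qed
  have N: "\<alpha> \<in> Norm" using \<alpha> conj conj' by (simp add: Norm_iff)
  have "\<Psi> \<alpha> = (\<lambda>x\<in>carrier G. x)"
  proof
    fix g show "\<Psi> \<alpha> g = (\<lambda>x\<in>carrier G. x) g"
    proof (cases "g \<in> carrier G")
      case True
      then show ?thesis using \<Psi>_eqI[OF N True True] conj by simp
    qed (simp add: conj_aut_def)
  qed
  then show "\<alpha> \<in> kernel NormG Aut \<Psi>" using N by (simp add: kernel_def one_TopAut)
qed

text \<open>Since \<open>U\<close> is the stabiliser of its own code, \<open>\<Psi> \<alpha>\<close> maps \<open>g <# U\<close> to a set determined by two values of \<open>\<alpha>\<close>.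
  This makes \<open>\<Psi>\<close> continuous.\<close>

lemma \<Psi>_image_coset:
  assumes \<alpha>: "\<alpha> \<in> Norm" and g: "g \<in> carrier G" and U: "U \<in> \<S>"
  shows "\<Psi> \<alpha> ` (g <# U) = {x \<in> carrier G. \<theta> x (\<alpha> (code (U, 0))) = \<alpha> (code (g <# U, 0))}"
proof -
  have gU: "g <# U \<subseteq> carrier G" using g U by (simp add: basis_subset l_coset_subset_G)
  have iff: "\<theta> (\<Psi> \<alpha> h) (\<alpha> (code (U, 0))) = \<alpha> (code (g <# U, 0)) \<longleftrightarrow> h \<in> g <# U" if h: "h \<in> carrier G" for h
  proof -
    have "\<theta> (\<Psi> \<alpha> h) (\<alpha> (code (U, 0))) = \<alpha> (code (h <# U, 0))"
      using \<alpha> h U by (simp add: \<theta>_\<Psi>_apply \<theta>_code basis_in_\<Omega>)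
    \<comment> \<open>Injectivity of \<open>\<alpha>\<close> and of \<open>code\<close> turns
      equality of values into equality of cosets.\<close>
    then have "\<theta> (\<Psi> \<alpha> h) (\<alpha> (code (U, 0))) = \<alpha> (code (g <# U, 0)) \<longleftrightarrow> h <# U = g <# U"
      using Norm_bij[OF \<alpha>] g h U by (simp add: bij_def inj_eq code_eq_iff \<Omega>I)
    then show ?thesis
      using g h U by (simp add: l_coset_eq_iff basis_subgroup l_coset_mem_iff basis_subset)
  qed
  show ?thesis
  proof (intro equalityI subsetI)
    fix x assume "x \<in> \<Psi> \<alpha> ` (g <# U)"
    then show "x \<in> {x \<in> carrier G. \<theta> x (\<alpha> (code (U, 0))) = \<alpha> (code (g <# U, 0))}"
      using iff gU \<Psi>_closed[OF \<alpha>] by auto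
  next
    fix x assume x: "x \<in> {x \<in> carrier G. \<theta> x (\<alpha> (code (U, 0))) = \<alpha> (code (g <# U, 0))}"
    have "\<Psi> \<alpha> ` carrier G = carrier G"
      using \<Psi>_TopAut[OF \<alpha>] by (simp add: carrier_TopAut bij_betw_def)
    then obtain h where "h \<in> carrier G" "x = \<Psi> \<alpha> h" using x by blast
    then show "x \<in> \<Psi> \<alpha> ` (g <# U)" using iff x by auto
  qed
qed

lemma continuous_map_\<Gamma>_\<Psi>: "continuous_map (subtopology Sinf_top Norm) Sinf_top (\<lambda>\<alpha>. \<Gamma> (\<Psi> \<alpha>))"
proof (rule continuous_map_into_Sinf)
  have top: "topspace (subtopology Sinf_top Norm) = Norm"
    using Norm_carrier by (auto simp: topspace_Sinf_top)
  show "\<Gamma> (\<Psi> \<alpha>) \<in> carrier Sinf" if "\<alpha> \<in> topspace (subtopology Sinf_top Norm)" for \<alpha>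
    using that unfolding top by (simp add: carrier_Sinf \<Gamma>_bij \<Psi>_TopAut)
  fix n m
  obtain A i where A: "A \<in> \<Omega>" "n = code (A, i)" by (rule code_cases)
  obtain g U where g: "g \<in> carrier G" "U \<in> \<S>" "A = g <# U" using A by (elim \<Omega>E)
  let ?X = "subtopology Sinf_top Norm"
  show "openin ?X {\<alpha> \<in> topspace ?X. \<Gamma> (\<Psi> \<alpha>) n = m}"
  proof (subst openin_subopen, intro ballI)
    fix \<alpha> assume "\<alpha> \<in> {\<alpha> \<in> topspace ?X. \<Gamma> (\<Psi> \<alpha>) n = m}"
    then have \<alpha>: "\<alpha> \<in> Norm" "\<Gamma> (\<Psi> \<alpha>) n = m" by (simp_all add: top)
    \<comment> \<open>Permutations in \<open>Norm\<close> agreeing with \<open>\<alpha>\<close> at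
      these two codes induce the same image of \<open>A\<close>, hence the same value at
      \<open>n\<close>.\<close>
    let ?V = "{\<beta> \<in> carrier Sinf. \<beta> (code (U, 0)) = \<alpha> (code (U, 0))} \<inter>
      {\<beta> \<in> carrier Sinf. \<beta> (code (g <# U, 0)) = \<alpha> (code (g <# U, 0))}"
    have "openin ?X (?V \<inter> Norm)"
      by (intro openin_subtopology_Int openin_Int openin_Sinf_top_eval)
    moreover have "\<Gamma> (\<Psi> \<beta>) n = m" if \<beta>: "\<beta> \<in> ?V \<inter> Norm" for \<beta>
    proof -
      have "\<Psi> \<beta> ` A = \<Psi> \<alpha> ` A" using \<beta> \<alpha>(1) g by (simp add: \<Psi>_image_coset)
      then show ?thesis using \<alpha>(2) A by (simp add: \<Gamma>_code)
    qed
    then have "?V \<inter> Norm \<subseteq> {\<alpha> \<in> topspace ?X. \<Gamma> (\<Psi> \<alpha>) n = m}" unfolding top by auto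
    moreover have "\<alpha> \<in> ?V \<inter> Norm" using \<alpha> Norm_carrier by auto
    ultimately show "\<exists>V. openin ?X V \<and> \<alpha> \<in> V \<and> V \<subseteq> {\<alpha> \<in> topspace ?X. \<Gamma> (\<Psi> \<alpha>) n = m}" by blast
  qed
qed

end

section \<open>The topology of the automorphism group\<close>

context invariant_basis
begin

abbreviation NormT where "NormT \<equiv> subtopology Sinf_top Norm"

definition \<tau> where "\<tau> = quotient_topology NormT \<Psi>"

lemma topspace_NormT: "topspace NormT = Norm"
  using Norm_carrier by (auto simp: topspace_Sinf_top)

lemma topspace_\<tau>: "topspace \<tau> = carrier Aut"
  unfolding \<tau>_def topspace_quotient_topology topspace_NormT by (rule \<Psi>_surj)

lemma quotient_map_\<Psi>: "quotient_map NormT \<tau> \<Psi>"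
  unfolding \<tau>_def by (rule quotient_map_quotient_topology)

lemma continuous_map_\<Gamma>: "continuous_map \<tau> Sinf_top \<Gamma>"
  by (rule continuous_compose_quotient_map[OF quotient_map_\<Psi>])
     (use continuous_map_\<Gamma>_\<Psi> in \<open>simp add: o_def\<close>)

text \<open>The inverse is a restriction of \<open>\<Psi>\<close>, which is continuous as a quotient
  map.\<close>

lemma homeomorphic_map_\<Gamma>: "homeomorphic_map \<tau> (subtopology Sinf_top (\<Gamma> ` carrier Aut)) \<Gamma>"
proof -
  have "continuous_map NormT \<tau> \<Psi>" by (rule quotient_imp_continuous_map[OF quotient_map_\<Psi>])
  moreover have "\<Gamma> ` carrier Aut \<subseteq> Norm" using \<Gamma>_Norm by blast
  ultimately have "continuous_map (subtopology Sinf_top (\<Gamma> ` carrier Aut)) \<tau> \<Psi>"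
    by (rule continuous_map_from_subtopology_mono)
  then have "homeomorphic_maps \<tau> (subtopology Sinf_top (\<Gamma> ` carrier Aut)) \<Gamma> \<Psi>"
    unfolding homeomorphic_maps_def
    using continuous_map_\<Gamma> by (auto simp: continuous_map_in_subtopology topspace_\<tau> \<Psi>_\<Gamma>)
  then show ?thesis by (rule homeomorphic_maps_imp_map)
qed

text \<open>On \<open>Norm\<close> the map \<open>\<Gamma>\<close> after \<open>\<Psi>\<close> is a
  continuous retraction onto this image, and the fixed points of a continuous self-map of a
  Hausdorff space form a closed set.\<close>

lemma closedin_\<Gamma>_image: "closedin Sinf_top (\<Gamma> ` carrier Aut)"
proof -
  let ?S = "\<Gamma> ` carrier Aut"
  have sub: "?S \<subseteq> Norm" using \<Gamma>_Norm by blast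
  have "NormT closure_of ?S \<subseteq> ?S"
  proof
    fix \<alpha> assume \<alpha>: "\<alpha> \<in> NormT closure_of ?S"
    then have N: "\<alpha> \<in> Norm" using closure_of_subset_topspace[of NormT ?S] unfolding topspace_NormT by blast
    have "Hausdorff_space Sinf_top"
      using completely_metrizable_Sinf_top completely_metrizable_imp_metrizable_space
        metrizable_imp_Hausdorff_space by blast
    moreover have "continuous_map NormT Sinf_top (\<lambda>\<alpha>. \<alpha>)"
      using continuous_map_from_subtopology[OF continuous_map_id[unfolded id_def]] .
    ultimately have "\<Gamma> (\<Psi> \<alpha>) = \<alpha>"
      by (rule forall_in_closure_of_eq[OF \<alpha> _ continuous_map_\<Gamma>_\<Psi>]) (auto simp: \<Psi>_\<Gamma>)
    then show "\<alpha> \<in> ?S" using \<Psi>_TopAut[OF N] by (metis image_eqI)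
  qed
  moreover have "?S \<subseteq> topspace NormT" using sub unfolding topspace_NormT .
  ultimately have "closedin NormT ?S" by (metis closure_of_subset_eq)
  then show ?thesis using closedin_Norm by (rule closedin_trans_full)
qed

lemma polish_group_\<tau>: "polish_group Aut \<tau>"
  unfolding polish_group_def
proof (intro conjI)
  show "topological_group Aut \<tau>"
    by (rule Sinf.topological_group_embedding[OF group_TopAut \<Gamma>_hom topspace_\<tau> homeomorphic_map_\<Gamma>])
  have hs: "\<tau> homeomorphic_space subtopology Sinf_top (\<Gamma> ` carrier Aut)"
    by (rule homeomorphic_map_imp_homeomorphic_space[OF homeomorphic_map_\<Gamma>])
  have "separable_space (subtopology Sinf_top (\<Gamma> ` carrier Aut))"
    by (intro second_countable_imp_separable_space second_countable_subtopology second_countable_Sinf_top)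
  then show "separable_space \<tau>" using homeomorphic_separable_space[OF hs] by blast
  have "completely_metrizable_space (subtopology Sinf_top (\<Gamma> ` carrier Aut))"
    by (rule completely_metrizable_space_closedin[OF completely_metrizable_Sinf_top closedin_\<Gamma>_image])
  then show "completely_metrizable_space \<tau>" using homeomorphic_completely_metrizable_space[OF hs] by blast
qed

text \<open>Through the embedding, \<open>\<tau>\<close> is the initial topology for
  \<open>\<Gamma>\<close>; neighbourhoods of the identity and uniqueness are both handled in this
  form.\<close>

lemma openin_\<tau>_iff:
  "openin \<tau> V \<longleftrightarrow> (\<exists>W. openin Sinf_top W \<and> V = {\<Phi> \<in> carrier Aut. \<Gamma> \<Phi> \<in> W})"
proof
  assume V: "openin \<tau> V"
  have VA: "V \<subseteq> carrier Aut" using openin_subset[OF V] topspace_\<tau> by simp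
  have "openin (subtopology Sinf_top (\<Gamma> ` carrier Aut)) (\<Gamma> ` V)"
    using homeomorphic_map_openness_eq[OF homeomorphic_map_\<Gamma>, of V] V by blast
  then obtain W where W: "openin Sinf_top W" "\<Gamma> ` V = W \<inter> \<Gamma> ` carrier Aut"
    unfolding openin_subtopology by blast
  have "V = {\<Phi> \<in> carrier Aut. \<Gamma> \<Phi> \<in> W}"
  proof (intro equalityI subsetI)
    fix \<Phi> assume "\<Phi> \<in> {\<Phi> \<in> carrier Aut. \<Gamma> \<Phi> \<in> W}"
    then have \<Phi>: "\<Phi> \<in> carrier Aut" "\<Gamma> \<Phi> \<in> \<Gamma> ` V" using W by auto
    then obtain \<Phi>' where "\<Phi>' \<in> V" "\<Gamma> \<Phi> = \<Gamma> \<Phi>'" by blast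
    then show "\<Phi> \<in> V" using \<Phi>(1) VA \<Psi>_\<Gamma> by (metis subsetD)
  qed (use W VA in blast)
  then show "\<exists>W. openin Sinf_top W \<and> V = {\<Phi> \<in> carrier Aut. \<Gamma> \<Phi> \<in> W}" using W by blast
next
  assume "\<exists>W. openin Sinf_top W \<and> V = {\<Phi> \<in> carrier Aut. \<Gamma> \<Phi> \<in> W}"
  then show "openin \<tau> V"
    using openin_continuous_map_preimage[OF continuous_map_\<Gamma>] by (auto simp: topspace_\<tau>)
qed

lemma openin_\<tau>_image:
  assumes "A \<in> \<Omega>" "B \<in> \<Omega>"
  shows "openin \<tau> {\<Phi> \<in> carrier Aut. \<Phi> ` A = B}"
proof -
  have "{\<Phi> \<in> carrier Aut. \<Phi> ` A = B} = {\<Phi> \<in> topspace \<tau>. \<Gamma> \<Phi> (code (A, 0)) = code (B, 0)}"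
    using assms by (auto simp: topspace_\<tau> \<Gamma>_code code_eq_iff TopAut_image_\<Omega>)
  then show ?thesis using continuous_map_from_Sinf[OF continuous_map_\<Gamma>] by simp
qed

section \<open>Stabilisers of cosets as neighbourhoods of the identity\<close>

definition coset_stab where "coset_stab F = {\<Phi> \<in> carrier Aut. \<forall>A\<in>F. \<Phi> ` A = A}"

text \<open>Order and repetition in a tuple do not affect its stabiliser, so finite sets can replace
  tuples; they allow induction and counting. The condition \<open>n \<ge> 1\<close> becomes
  \<open>F \<noteq> {}\<close>.\<close>

lemma coset_stabilizers_eq:
  "coset_stabilizers G T \<S> = coset_stab ` {F. finite F \<and> F \<noteq> {} \<and> F \<subseteq> \<Omega>}"
proof (intro equalityI subsetI)
  fix V assume "V \<in> coset_stabilizers G T \<S>"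
  then obtain n :: nat and A where nA: "n \<ge> 1" "\<And>i. i \<in> {1..n} \<Longrightarrow> A i \<in> \<Omega>"
    "V = {\<Phi> \<in> carrier Aut. \<forall>i\<in>{1..n}. \<Phi> ` A i = A i}"
    unfolding coset_stabilizers_def cosets_of_eq by blast
  have "V = coset_stab (A ` {1..n})" using nA(3) by (auto simp: coset_stab_def)
  moreover have "finite (A ` {1..n})" "A ` {1..n} \<noteq> {}" "A ` {1..n} \<subseteq> \<Omega>" using nA(1,2) by auto
  ultimately show "V \<in> coset_stab ` {F. finite F \<and> F \<noteq> {} \<and> F \<subseteq> \<Omega>}" by blast
next
  fix V assume "V \<in> coset_stab ` {F. finite F \<and> F \<noteq> {} \<and> F \<subseteq> \<Omega>}"
  then obtain F where F: "finite F" "F \<noteq> {}" "F \<subseteq> \<Omega>" "V = coset_stab F" by blast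
  obtain h where h: "bij_betw h {1..card F} F" using ex_bij_betw_nat_finite_1[OF F(1)] by blast
  then have hF: "F = h ` {1..card F}" by (simp add: bij_betw_def)
  have "(\<forall>A\<in>F. \<Phi> ` A = A) \<longleftrightarrow> (\<forall>i\<in>{1..card F}. \<Phi> ` h i = h i)" for \<Phi> :: "'a \<Rightarrow> 'a"
    by (subst hF) simp
  then have "V = {\<Phi> \<in> carrier Aut. \<forall>i\<in>{1..card F}. \<Phi> ` h i = h i}"
    unfolding F(4) coset_stab_def by simp
  moreover have "card F \<ge> 1" using F(1,2) by (simp add: Suc_le_eq card_gt_0_iff)
  moreover have "\<forall>i\<in>{1..card F}. h i \<in> \<Omega>" using hF F(3) by blast
  ultimately show "V \<in> coset_stabilizers G T \<S>"
    unfolding coset_stabilizers_def cosets_of_eq by blast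
qed

lemma openin_coset_stab:
  assumes "finite F" "F \<subseteq> \<Omega>"
  shows "openin \<tau> (coset_stab F)"
  using assms
proof (induction F)
  case empty
  have "coset_stab {} = topspace \<tau>" by (simp add: coset_stab_def topspace_\<tau>)
  then show ?case by simp
next
  case (insert A F)
  have "coset_stab (insert A F) = {\<Phi> \<in> carrier Aut. \<Phi> ` A = A} \<inter> coset_stab F"
    by (auto simp: coset_stab_def)
  then show ?case using insert by (auto intro!: openin_Int openin_\<tau>_image)
qed

lemma subgroup_coset_stab:
  assumes "F \<subseteq> \<Omega>"
  shows "subgroup (coset_stab F) Aut"
proof (rule \<Psi>.H.subgroupI)
  have FG: "A \<subseteq> carrier G" if "A \<in> F" for A using that assms \<Omega>_subset by blast
  show "coset_stab F \<subseteq> carrier Aut" by (auto simp: coset_stab_def)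
  have "\<one>\<^bsub>Aut\<^esub> ` A = A" if "A \<in> F" for A
    using FG[OF that] by (force simp: one_TopAut image_iff)
  then have "\<one>\<^bsub>Aut\<^esub> \<in> coset_stab F" by (simp add: coset_stab_def)
  then show "coset_stab F \<noteq> {}" by blast
  fix \<Phi> assume \<Phi>: "\<Phi> \<in> coset_stab F"
  then have "(inv\<^bsub>Aut\<^esub> \<Phi>) ` A = A" if "A \<in> F" for A
    using TopAut_inv_image(1)[of \<Phi> A] FG[OF that] that by (simp add: coset_stab_def)
  then show "inv\<^bsub>Aut\<^esub> \<Phi> \<in> coset_stab F" using \<Phi> by (simp add: coset_stab_def)
  fix \<Phi>' assume \<Phi>': "\<Phi>' \<in> coset_stab F"
  then show "\<Phi> \<otimes>\<^bsub>Aut\<^esub> \<Phi>' \<in> coset_stab F"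
    using \<Phi> FG by (simp add: coset_stab_def TopAut_mult_image)
qed

lemma coset_stab_neighbourhood:
  assumes V: "openin \<tau> V" "\<one>\<^bsub>Aut\<^esub> \<in> V"
  obtains F where "finite F" "F \<noteq> {}" "F \<subseteq> \<Omega>" "coset_stab F \<subseteq> V"
proof -
  obtain W where W: "openin Sinf_top W" "V = {\<Phi> \<in> carrier Aut. \<Gamma> \<Phi> \<in> W}"
    using V(1) openin_\<tau>_iff by blast
  have "\<Gamma> \<one>\<^bsub>Aut\<^esub> = id"
    using hom_one[OF \<Gamma>_hom group_TopAut group_Sinf] by (simp add: one_Sinf)
  then have "id \<in> W" using V W by auto
  then obtain N where N: "finite N" "\<And>f. f \<in> carrier Sinf \<Longrightarrow> (\<And>n. n \<in> N \<Longrightarrow> f n = id n) \<Longrightarrow> f \<in> W"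
    using openin_Sinf_top_finite[OF W(1)] by metis
  obtain U where U: "U \<in> \<S>" using basis_nonempty by blast
  \<comment> \<open>The number \<open>n\<close> is fixed by \<open>\<Gamma> \<Phi>\<close> as soon
    as the coset \<open>c n\<close> coded in it is mapped to itself.\<close>
  have "\<exists>A. A \<in> \<Omega> \<and> (\<exists>i. n = code (A, i))" for n using code_cases[of n] by metis
  then obtain c where c: "\<And>n. c n \<in> \<Omega>" "\<And>n. \<exists>i. n = code (c n, i)" by metis
  \<comment> \<open>Including \<open>U\<close> keeps the set nonempty when \<open>N\<close> is
    empty.\<close>
  let ?F = "insert U (c ` N)"
  have "\<Phi> \<in> V" if \<Phi>: "\<Phi> \<in> coset_stab ?F" for \<Phi>
  proof -
    have "\<Gamma> \<Phi> n = id n" if "n \<in> N" for n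
    proof -
      obtain i where i: "n = code (c n, i)" using c(2) by blast
      have "\<Gamma> \<Phi> n = code (\<Phi> ` c n, i)" using \<Gamma>_code[OF c(1), of \<Phi> n i] i by simp
      then show ?thesis using \<Phi> i that by (simp add: coset_stab_def)
    qed
    then show ?thesis using \<Phi> N(2) W(2) by (simp add: coset_stab_def carrier_Sinf \<Gamma>_bij)
  qed
  then show thesis
    using that[of ?F] N(1) c(1) basis_in_\<Omega>[OF U] by blast
qed

lemma neighbourhood_basis_coset_stabilizers:
  "neighbourhood_basis \<tau> \<one>\<^bsub>Aut\<^esub> (coset_stabilizers G T \<S>)"
  unfolding neighbourhood_basis_def neighbourhood_base_at_def coset_stabilizers_eq
proof (intro conjI ballI allI impI)
  fix V assume "V \<in> coset_stab ` {F. finite F \<and> F \<noteq> {} \<and> F \<subseteq> \<Omega>}"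
  then have "openin \<tau> V" "\<one>\<^bsub>Aut\<^esub> \<in> V"
    using openin_coset_stab subgroup.one_closed[OF subgroup_coset_stab] by blast+
  then show "V \<subseteq> topspace \<tau>" "\<exists>U. openin \<tau> U \<and> \<one>\<^bsub>Aut\<^esub> \<in> U \<and> U \<subseteq> V"
    using openin_subset by blast+
next
  fix W assume "openin \<tau> W \<and> \<one>\<^bsub>Aut\<^esub> \<in> W"
  then obtain F where F: "finite F" "F \<noteq> {}" "F \<subseteq> \<Omega>" "coset_stab F \<subseteq> W"
    using coset_stab_neighbourhood by blast
  then show "\<exists>U V. openin \<tau> U \<and> V \<in> coset_stab ` {F. finite F \<and> F \<noteq> {} \<and> F \<subseteq> \<Omega>} \<and>
      \<one>\<^bsub>Aut\<^esub> \<in> U \<and> U \<subseteq> V \<and> V \<subseteq> W"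
    using openin_coset_stab[of F] subgroup.one_closed[OF subgroup_coset_stab, of F]
    by (intro exI[of _ "coset_stab F"]) auto
qed

lemma non_archimedean_\<tau>: "non_archimedean Aut \<tau>"
  unfolding non_archimedean_def open_subgroup_basis_def
proof (intro exI conjI)
  have "countable {F. finite F \<and> F \<subseteq> \<Omega>}"
    using countable_Collect_finite_subset[OF countable_\<Omega>] by (simp add: conj_commute)
  then have "countable {F. finite F \<and> F \<noteq> {} \<and> F \<subseteq> \<Omega>}"
    by (rule countable_subset[rotated]) auto
  then show "countable (coset_stabilizers G T \<S>)" unfolding coset_stabilizers_eq by (rule countable_image)
  show "\<forall>V\<in>coset_stabilizers G T \<S>. subgroup V Aut \<and> openin \<tau> V"
    unfolding coset_stabilizers_eq using openin_coset_stab subgroup_coset_stab by blast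
  show "neighbourhood_basis \<tau> \<one>\<^bsub>Aut\<^esub> (coset_stabilizers G T \<S>)"
    by (rule neighbourhood_basis_coset_stabilizers)
qed

lemma continuous_action: "continuous_map (prod_topology \<tau> T) T (\<lambda>(\<Phi>, g). \<Phi> g)"
  unfolding continuous_map_def
proof (intro conjI allI impI)
  show "(\<lambda>(\<Phi>, g). \<Phi> g) \<in> topspace (prod_topology \<tau> T) \<rightarrow> topspace T"
    by (auto simp: topspace_\<tau> topspace_eq TopAut_closed)
  fix W assume W: "openin T W"
  let ?P = "{z \<in> topspace (prod_topology \<tau> T). (\<lambda>(\<Phi>, g). \<Phi> g) z \<in> W}"
  show "openin (prod_topology \<tau> T) ?P"
    unfolding openin_prod_topology_alt
  proof (intro allI impI)
    fix \<Phi> g assume "(\<Phi>, g) \<in> ?P"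
    then have \<Phi>: "\<Phi> \<in> carrier Aut" and g: "g \<in> carrier G" and W': "\<Phi> g \<in> W"
      by (auto simp: topspace_\<tau> topspace_eq)
    obtain U where U: "U \<in> \<S>" "\<Phi> g <# U \<subseteq> W" using basis_coset[OF W W'] .
    \<comment> \<open>This is basic by invariance, and \<open>\<Phi>\<close> maps the coset
      \<open>g <# ?U\<close> onto \<open>\<Phi> g <# U\<close>. Automorphisms near
      \<open>\<Phi>\<close> send that coset to the same place.\<close>
    let ?U = "(inv\<^bsub>Aut\<^esub> \<Phi>) ` U"
    have U': "?U \<in> \<S>" using \<Phi> U by (intro invariant inv_TopAut_closed)
    have "\<Phi> ` (g <# ?U) = \<Phi> g <# U"
      using \<Phi> g by (simp add: TopAut_image_l_coset basis_subset[OF U'] TopAut_inv_image basis_subset[OF U(1)])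
    let ?V = "{\<Phi>' \<in> carrier Aut. \<Phi>' ` (g <# ?U) = \<Phi> ` (g <# ?U)}"
    have "openin \<tau> ?V" using \<Phi> g U' by (intro openin_\<tau>_image TopAut_image_\<Omega> \<Omega>I)
    moreover have "openin T (g <# ?U)" using g U' by (intro openin_l_coset basis_open)
    moreover have "g \<in> g <# ?U"
      using g subgroup.one_closed[OF basis_subgroup[OF U']] basis_subset[OF U'] by (subst l_coset_mem_iff) auto
    moreover have "?V \<times> (g <# ?U) \<subseteq> ?P"
    proof
      fix z assume "z \<in> ?V \<times> (g <# ?U)"
      then obtain \<Phi>' x where \<Phi>': "\<Phi>' \<in> carrier Aut" "\<Phi>' ` (g <# ?U) = \<Phi> ` (g <# ?U)"
        and x: "x \<in> g <# ?U" and z: "z = (\<Phi>', x)" by blast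
      have "\<Phi>' x \<in> \<Phi>' ` (g <# ?U)" using x by blast
      then have "\<Phi>' x \<in> W" using \<Phi>'(2) \<open>\<Phi> ` (g <# ?U) = \<Phi> g <# U\<close> U(2) by blast
      moreover have "x \<in> carrier G" using x g U' \<Omega>I \<Omega>_subset by blast
      ultimately show "z \<in> ?P"
        using \<Phi>' z by (simp add: topspace_\<tau> topspace_eq)
    qed
    ultimately show "\<exists>V1 V2. openin \<tau> V1 \<and> openin T V2 \<and> \<Phi> \<in> V1 \<and> g \<in> V2 \<and> V1 \<times> V2 \<subseteq> ?P"
      using \<Phi> by (intro exI[of _ ?V] exI[of _ "g <# ?U"]) blast
  qed
qed

section \<open>Uniqueness of the Polish topology\<close>

lemma polish_topology_unique:
  assumes \<sigma>: "polish_group Aut \<sigma>" and act: "continuous_map (prod_topology \<sigma> T) T (\<lambda>(\<Phi>, g). \<Phi> g)"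
  shows "\<sigma> = \<tau>"
proof -
  interpret \<sigma>: topgroup Aut \<sigma> using \<sigma> by unfold_locales (simp add: polish_group_def)
  interpret \<tau>: topgroup Aut \<tau> using polish_group_\<tau> by unfold_locales (simp add: polish_group_def)
  have cm: "completely_metrizable_space \<sigma>" "completely_metrizable_space \<tau>"
    using \<sigma> polish_group_\<tau> by (simp_all add: polish_group_def)
  have eval: "continuous_map \<sigma> T (\<lambda>\<Phi>. \<Phi> x)" if "x \<in> carrier G" for x
  proof -
    have "continuous_map \<sigma> (prod_topology \<sigma> T) (\<lambda>\<Phi>. (\<Phi>, x))"
      using that by (intro continuous_map_pairedI continuous_map_id[unfolded id_def] continuous_map_constant)
    from continuous_map_compose[OF this act] show ?thesis by (simp add: o_def)
  qed
  \<comment> \<open>The inclusion is an intersection of conditions on evaluations, closed because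
    open cosets are closed. Equality is not directly of this form.\<close>
  have closed: "closedin \<sigma> {\<Phi> \<in> carrier Aut. \<Phi> ` A \<subseteq> A}" if A: "A \<in> \<Omega>" for A
  proof -
    obtain g U where g: "g \<in> carrier G" "U \<in> \<S>" "A = g <# U" using A by (rule \<Omega>E)
    have "closedin T A"
      using g by (simp add: closedin_l_coset open_subgroup_closed basis_subgroup basis_open)
    then have "closedin \<sigma> {\<Phi> \<in> topspace \<sigma>. \<Phi> a \<in> A}" if "a \<in> A" for a
      using that \<Omega>_subset[OF A] by (intro closedin_continuous_map_preimage[OF eval]) auto
    moreover have "A \<noteq> {}" using g subgroup.one_closed[OF basis_subgroup] by (auto simp: l_coset_def)
    ultimately have "closedin \<sigma> (\<Inter>a\<in>A. {\<Phi> \<in> topspace \<sigma>. \<Phi> a \<in> A})" by (intro closedin_INT)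
    moreover have "{\<Phi> \<in> carrier Aut. \<Phi> ` A \<subseteq> A} = (\<Inter>a\<in>A. {\<Phi> \<in> topspace \<sigma>. \<Phi> a \<in> A})"
      using \<open>A \<noteq> {}\<close> by (auto simp: \<sigma>.topspace_eq)
    ultimately show ?thesis by simp
  qed
  have stab_open: "openin \<sigma> (coset_stab {A})" if A: "A \<in> \<Omega>" for A
  proof (rule \<sigma>.closed_subgroup_countable_index_open[OF cm(1)])
    let ?C = "{\<Phi> \<in> carrier Aut. \<Phi> ` A \<subseteq> A}"
    show "subgroup (coset_stab {A}) Aut" using A by (intro subgroup_coset_stab) auto
    \<comment> \<open>The reverse inclusion is expressed through the inverse automorphism, and
      inversion is continuous for \<open>\<sigma>\<close>.\<close>
    have "closedin \<sigma> {\<Phi> \<in> topspace \<sigma>. inv\<^bsub>Aut\<^esub> \<Phi> \<in> ?C}"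
      by (intro closedin_continuous_map_preimage[OF _ closed[OF A]] \<sigma>.continuous_map_inv
        continuous_map_id[unfolded id_def])
    moreover have "coset_stab {A} = ?C \<inter> {\<Phi> \<in> topspace \<sigma>. inv\<^bsub>Aut\<^esub> \<Phi> \<in> ?C}"
    proof -
      have "\<Phi> ` A = A \<longleftrightarrow> \<Phi> ` A \<subseteq> A \<and> (inv\<^bsub>Aut\<^esub> \<Phi>) ` A \<subseteq> A" if "\<Phi> \<in> carrier Aut" for \<Phi>
        using TopAut_inv_image[OF that \<Omega>_subset[OF A]] by (metis image_mono subset_antisym subset_refl)
      then have "{\<Phi> \<in> carrier Aut. \<Phi> ` A = A} = ?C \<inter> {\<Phi> \<in> carrier Aut. (inv\<^bsub>Aut\<^esub> \<Phi>) ` A \<subseteq> A}" by blast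
      then show ?thesis by (simp add: coset_stab_def \<sigma>.topspace_eq inv_TopAut_closed cong: conj_cong)
    qed
    ultimately show "closedin \<sigma> (coset_stab {A})" using closed[OF A] by (simp add: closedin_Int)
    \<comment> \<open>The label of an automorphism is its image of \<open>A\<close>, a member of the
      countable set \<open>\<Omega>\<close>.\<close>
    show "countable ((\<lambda>\<Phi>. \<Phi> ` A) ` carrier Aut)"
      by (rule countable_subset[OF _ countable_\<Omega>]) (use A TopAut_image_\<Omega> in auto)
    fix \<Phi> \<Phi>' assume *: "\<Phi> \<in> carrier Aut" "\<Phi>' \<in> carrier Aut" "\<Phi> ` A = \<Phi>' ` A"
    then show "inv\<^bsub>Aut\<^esub> \<Phi> \<otimes>\<^bsub>Aut\<^esub> \<Phi>' \<in> coset_stab {A}"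
      using \<Omega>_subset[OF A] TopAut_inv_image(1)[OF *(1) \<Omega>_subset[OF A]]
      by (simp add: coset_stab_def TopAut_mult_image)
  qed
  have "continuous_map \<sigma> Sinf_top \<Gamma>"
  proof (rule continuous_map_into_Sinf)
    show "\<Gamma> \<Phi> \<in> carrier Sinf" if "\<Phi> \<in> topspace \<sigma>" for \<Phi>
      using that by (simp add: \<sigma>.topspace_eq carrier_Sinf \<Gamma>_bij)
    fix n m
    obtain A i where A: "A \<in> \<Omega>" "n = code (A, i)" by (rule code_cases)
    show "openin \<sigma> {\<Phi> \<in> topspace \<sigma>. \<Gamma> \<Phi> n = m}"
    proof (subst openin_subopen, intro ballI)
      fix \<Phi> assume "\<Phi> \<in> {\<Phi> \<in> topspace \<sigma>. \<Gamma> \<Phi> n = m}"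
      then have \<Phi>: "\<Phi> \<in> carrier Aut" "\<Gamma> \<Phi> n = m" by (auto simp: \<sigma>.topspace_eq)
      \<comment> \<open>All automorphisms in this coset have the same image of \<open>A\<close>, so
        their \<open>\<Gamma>\<close>-values at \<open>n\<close> agree.\<close>
      let ?V = "\<Phi> <#\<^bsub>Aut\<^esub> coset_stab {A}"
      have sg: "subgroup (coset_stab {A}) Aut" using A by (intro subgroup_coset_stab) auto
      have "openin \<sigma> ?V" by (intro \<sigma>.openin_l_coset \<Phi>(1) stab_open A(1))
      moreover have "\<Phi> \<in> ?V"
        using \<Phi> subgroup.one_closed[OF sg] subgroup.subset[OF sg] by (subst \<sigma>.l_coset_mem_iff) auto
      moreover have "?V \<subseteq> {\<Phi> \<in> topspace \<sigma>. \<Gamma> \<Phi> n = m}"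
      proof
        fix \<Phi>' assume "\<Phi>' \<in> ?V"
        then obtain \<Xi> where \<Xi>: "\<Xi> \<in> coset_stab {A}" "\<Phi>' = \<Phi> \<otimes>\<^bsub>Aut\<^esub> \<Xi>" by (auto simp: l_coset_def)
        then have "\<Xi> \<in> carrier Aut" "\<Xi> ` A = A" by (auto simp: coset_stab_def)
        then have "\<Phi>' ` A = \<Phi> ` A" "\<Phi>' \<in> carrier Aut"
          using \<Xi>(2) \<Phi>(1) \<Omega>_subset[OF A(1)] by (simp_all add: TopAut_mult_image)
        then show "\<Phi>' \<in> {\<Phi> \<in> topspace \<sigma>. \<Gamma> \<Phi> n = m}"
          using \<Phi>(2) A by (simp add: \<Gamma>_code \<sigma>.topspace_eq)
      qed
      ultimately show "\<exists>V. openin \<sigma> V \<and> \<Phi> \<in> V \<and> V \<subseteq> {\<Phi> \<in> topspace \<sigma>. \<Gamma> \<Phi> n = m}" by blast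
    qed
  qed
  then have "openin \<sigma> V" if "openin \<tau> V" for V
    using that openin_continuous_map_preimage[of \<sigma> Sinf_top \<Gamma>]
    unfolding openin_\<tau>_iff \<sigma>.topspace_eq by blast
  then show ?thesis by (rule \<tau>.finer_polish_topology_eq[OF \<sigma> cm(2)])
qed

text \<open>Both \<open>\<Psi>\<close> and the projection to the factor group are quotient maps, so
  the induced map is one too, and it is injective modulo the kernel. Hence the direct definition of
  \<open>\<tau>\<close> agrees with the topology transferred from the factor group.\<close>

lemma FactGroup_homeomorphic:
  "homeomorphic_map (FactGroup_top NormG NormT (kernel NormG Aut \<Psi>)) \<tau> (\<lambda>X. the_elem (\<Psi> ` X))"
proof -
  let ?C = "kernel NormG Aut \<Psi>" and ?q = "\<lambda>x. kernel NormG Aut \<Psi> #>\<^bsub>NormG\<^esub> x"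
  let ?F = "FactGroup_top NormG NormT ?C" and ?\<Psi>bar = "\<lambda>X. the_elem (\<Psi> ` X)"
  have q: "quotient_map NormT ?F ?q"
    unfolding FactGroup_top_def by (rule quotient_map_quotient_topology)
  have "?\<Psi>bar (?q \<alpha>) = \<Psi> \<alpha>" if \<alpha>: "\<alpha> \<in> Norm" for \<alpha>
  proof -
    have "\<Psi> ` ?q \<alpha> = {\<Psi> \<alpha>}"
    proof (intro equalityI subsetI)
      fix \<Phi> assume "\<Phi> \<in> \<Psi> ` ?q \<alpha>"
      then obtain \<kappa> where "\<kappa> \<in> ?C" "\<Phi> = \<Psi> (\<kappa> \<otimes>\<^bsub>NormG\<^esub> \<alpha>)" unfolding r_coset_def by blast
      then have "\<Phi> = \<Psi> \<kappa> \<otimes>\<^bsub>Aut\<^esub> \<Psi> \<alpha>" "\<Psi> \<kappa> = \<one>\<^bsub>Aut\<^esub>"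
        using \<alpha> \<Psi>.hom_mult[of \<kappa> \<alpha>] by (auto simp: kernel_def)
      then show "\<Phi> \<in> {\<Psi> \<alpha>}" using \<alpha> by (simp add: \<Psi>_TopAut)
    next
      fix \<Phi> assume "\<Phi> \<in> {\<Psi> \<alpha>}"
      moreover have "\<alpha> \<in> ?q \<alpha>"
        using \<alpha> \<Psi>.G.rcos_self[OF _ \<Psi>.subgroup_kernel] by simp
      ultimately show "\<Phi> \<in> \<Psi> ` ?q \<alpha>" by blast
    qed
    then show ?thesis by simp
  qed
  then have "quotient_map NormT \<tau> (?\<Psi>bar \<circ> ?q)"
    using topspace_NormT by (intro quotient_map_eq[OF quotient_map_\<Psi>]) simp
  then have "quotient_map ?F \<tau> ?\<Psi>bar"
    using quotient_map_compose_eq[OF q] by blast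
  moreover have "topspace ?F = carrier (NormG Mod ?C)"
    unfolding FactGroup_top_def topspace_quotient_topology topspace_NormT
    by (auto simp: FactGroup_def RCOSETS_def)
  then have "inj_on ?\<Psi>bar (topspace ?F)" using \<Psi>.FactGroup_inj_on by simp
  ultimately show ?thesis by (simp add: homeomorphic_map_def)
qed

lemma FactGroup_iso_\<Psi>: "(\<lambda>X. the_elem (\<Psi> ` X)) \<in> iso (NormG Mod kernel NormG Aut \<Psi>) Aut"
  by (rule \<Psi>.FactGroup_iso_set) (simp add: \<Psi>_surj)

end

theorem theorem2p1:
  fixes G :: "('a, 'b) monoid_scheme" and T :: "'a topology" and \<S> :: "'a set set"
  assumes "polish_group G T"
    and "open_subgroup_basis G T \<S>"
    and "\<And>\<Phi> U. \<Phi> \<in> carrier (TopAut G T) \<Longrightarrow> U \<in> \<S> \<Longrightarrow> \<Phi> ` U \<in> \<S>"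
  shows "\<exists>Ghat \<Theta>.
    subgroup Ghat Sinf \<and> closedin Sinf_top Ghat \<and>
    \<Theta> \<in> iso G (Sinf\<lparr>carrier := Ghat\<rparr>) \<and>
    homeomorphic_map T (subtopology Sinf_top Ghat) \<Theta> \<and>
    (let N = Sinf\<lparr>carrier := normalizer Sinf Ghat\<rparr>;
         C = centralizer Sinf Ghat;
         Aut = TopAut G T;
         \<Psi> = conj_aut G \<Theta>;
         \<Psi>bar = (\<lambda>X. the_elem (\<Psi> ` X))
     in \<Psi> \<in> hom N Aut \<and> \<Psi> ` carrier N = carrier Aut \<and> kernel N Aut \<Psi> = C \<and>
        \<Psi>bar \<in> iso (N Mod C) Aut \<and>
        (\<exists>\<tau>. homeomorphic_map
                (FactGroup_top N (subtopology Sinf_top (carrier N)) C) \<tau> \<Psi>bar \<and>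
             polish_group Aut \<tau> \<and> non_archimedean Aut \<tau> \<and>
             continuous_map (prod_topology \<tau> T) T (\<lambda>(\<Phi>, g). \<Phi> g) \<and>
             (\<forall>V \<in> coset_stabilizers G T \<S>. subgroup V Aut) \<and>
             neighbourhood_basis \<tau> \<one>\<^bsub>Aut\<^esub> (coset_stabilizers G T \<S>) \<and>
             (\<forall>\<sigma>. polish_group Aut \<sigma> \<and>
                  continuous_map (prod_topology \<sigma> T) T (\<lambda>(\<Phi>, g). \<Phi> g) \<longrightarrow> \<sigma> = \<tau>)))"
proof -
  interpret invariant_basis G T \<S>
    using assms by unfold_locales (auto simp: polish_group_def)
  have "\<forall>V\<in>coset_stabilizers G T \<S>. subgroup V Aut"
    unfolding coset_stabilizers_eq using subgroup_coset_stab by blast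
  then show ?thesis
    unfolding Let_def partial_object.simps(3)
    by (intro exI[of _ Ghat] exI[of _ \<theta>] conjI exI[of _ \<tau>] allI impI)
       (simp_all add: subgroup_Ghat closedin_Ghat iso_\<theta> homeomorphic_map_\<theta> \<Psi>_hom \<Psi>_surj kernel_\<Psi>
         FactGroup_iso_\<Psi>[unfolded kernel_\<Psi>] FactGroup_homeomorphic[unfolded kernel_\<Psi>] polish_group_\<tau>
         non_archimedean_\<tau> continuous_action neighbourhood_basis_coset_stabilizers polish_topology_unique)
qed

end
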